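(* Let $c\in\mathbb{C}$, $q(x)=x^2+c$, and for $b\in\mathbb{C}$ let $H_b:\mathbb{C}^2\to\mathbb{C}^2$, $H_b(x,y)=(x^2+c-by,x)$. Let $\Lambda\subseteq J(q)$ be an expanding compact invariant set of $q$, and let $\mathcal{A}:=\{(q(x),x):x\in\Lambda\}\subset\mathbb{C}^2$. Then there exists $\epsilon_0>0$ such that if $0<|b|<\epsilon_0$, then there exist a hyperbolic compact invariant set $\mathcal{A}_b\subset\mathbb{C}^2$ for $H_b$ and homeomorphisms $$\Psi:\varprojlim(\Lambda,q)\to\varprojlim(\mathcal{A},H_0),\qquad \Upsilon_b:\varprojlim(\mathcal{A},H_0)\to\mathcal{A}_b$$ such that $$\Psi\circ\sigma_q=\sigma_\dagger\circ\Psi\quad\text{on }\varprojlim(\Lambda,q),\qquad \Upsilon_b\circ\sigma_\dagger=H_b\circ\Upsilon_b\quad\text{on }\varprojlim(\mathcal{A},H_0),$$ where $\sigma_q$ and $\sigma_\dagger$ are the shift maps on the projective limit spaces induced by $q$ and by $H_0$, respectively.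
   Context: A set $S$ is invariant under a map $f$ if $f^{-1}(S)=S$. For $q(x)=x^2+c$, $K(q)$ is the set of points with bounded forward orbit and the Julia set $J(q)$ is the boundary of $K(q)$ in $\mathbb{C}$. An invariant set $S\subset\mathbb{C}$ of a differentiable map $f$ of $\mathbb{C}$ is (uniformly) expanding if there exist $C_u>0$, $\lambda_u>1$ such that $\|Df^n(z)\|\ge C_u\lambda_u^n$ for all $z\in S$, $n\ge1$, for some norm on $\mathbb{C}$. A compact invariant set $S$ of a diffeomorphism $f$ of $\mathbb{C}^2$ is (uniformly) hyperbolic if there are constants $C_s,C_u>0$, $0<\lambda_s<1<\lambda_u$ and, for each $z\in S$, a splitting $T_z\mathbb{C}^2=E^s_z\oplus E^u_z$ varying continuously with $z$, with $Df(z)E^{s/u}_z=E^{s/u}_{f(z)}$, $\|Df^n(z)|_{E^s_z}\|\le C_s\lambda_s^n$ and $\|Df^{-n}(z)|_{E^u_z}\|\le C_u\lambda_u^{-n}$ for all $z\in S$, $n\ge1$, for some norm on $\mathbb{C}^2$. For a continuous map $f$ and a bounded set $S$ with $f(S)\subseteq S$, the projective limit space is $\varprojlim(S,f)=\{(\ldots,z_{-1},z_0): z_i\in S,\ f(z_{i-1})=z_i\ \text{for all } i\le0\}$ with the product topology, and the induced shift map is $(\ldots,z_{-1},z_0)\mapsto(\ldots,z_{-1},z_0,f(z_0))$. *)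

theory Defs
  imports "HOL-Analysis.Analysis"
begin

definition invariant_set :: "('a \<Rightarrow> 'a) \<Rightarrow> 'a set \<Rightarrow> bool" where
  "invariant_set f S \<longleftrightarrow> f -` S = S"

definition filled_julia :: "(complex \<Rightarrow> complex) \<Rightarrow> complex set" where
  "filled_julia f = {z. bounded (range (\<lambda>n. (f ^^ n) z))}"

definition julia :: "(complex \<Rightarrow> complex) \<Rightarrow> complex set" where
  "julia f = frontier (filled_julia f)"

(* The product type complex \<times> complex carries only a real vector space structure in the
   library; this is its complex scalar multiplication. *)
definition cscale :: "complex \<Rightarrow> complex \<times> complex \<Rightarrow> complex \<times> complex" where
  "cscale a v = (a * fst v, a * snd v)"

interpretation C2: vector_space cscale
  by standard (auto simp: cscale_def algebra_simps)

(* N is a norm on a complex vector space whose scalar multiplication is the first argument;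
   it need not be the norm of the type class. *)
definition is_norm ::
  "(complex \<Rightarrow> 'v \<Rightarrow> 'v) \<Rightarrow> ('v::real_vector \<Rightarrow> real) \<Rightarrow> bool" where
  "is_norm sc N \<longleftrightarrow>
     (\<forall>v. 0 \<le> N v) \<and> (\<forall>v. N v = 0 \<longleftrightarrow> v = 0) \<and>
     (\<forall>a v. N (sc a v) = cmod a * N v) \<and>
     (\<forall>u v. N (u + v) \<le> N u + N v)"

(* Operator norm, with respect to N, of the restriction of A to the subspace E. As in the
   library's onorm, v = 0 contributes 0 / 0 = 0, so the value is 0 for E = {0}. *)
definition op_norm_on :: "('v \<Rightarrow> real) \<Rightarrow> 'v set \<Rightarrow> ('v \<Rightarrow> 'v) \<Rightarrow> real" where
  "op_norm_on N E A = (SUP v\<in>E. N (A v) / N v)"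

definition expanding :: "(complex \<Rightarrow> complex) \<Rightarrow> complex set \<Rightarrow> bool" where
  "expanding f S \<longleftrightarrow>
     f differentiable_on UNIV \<and> invariant_set f S \<and>
     (\<exists>N Cu lu. is_norm (*) N \<and> Cu > 0 \<and> lu > 1 \<and>
        (\<forall>z\<in>S. \<forall>n\<ge>1.
           op_norm_on N UNIV (frechet_derivative (f ^^ n) (at z)) \<ge> Cu * lu ^ n))"

definition C1_map :: "('v::euclidean_space \<Rightarrow> 'v) \<Rightarrow> bool" where
  "C1_map f \<longleftrightarrow>
     f differentiable_on UNIV \<and>
     (\<forall>v. continuous_on UNIV (\<lambda>z. frechet_derivative f (at z) v))"

definition diffeomorphism :: "('v::euclidean_space \<Rightarrow> 'v) \<Rightarrow> bool" where
  "diffeomorphism f \<longleftrightarrow> bij f \<and> C1_map f \<and> C1_map (inv f)"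

(* Continuity of z \<mapsto> E z into the Grassmannian of complex subspaces, expressed by
   continuous local frames; in particular the dimension of E z is locally constant. *)
definition continuous_subspaces_on ::
  "(complex \<times> complex) set \<Rightarrow> (complex \<times> complex \<Rightarrow> (complex \<times> complex) set) \<Rightarrow> bool" where
  "continuous_subspaces_on S E \<longleftrightarrow>
     (\<forall>z\<in>S. \<exists>U k e. open U \<and> z \<in> U \<and>
        (\<forall>i<(k::nat). continuous_on (S \<inter> U) (e i)) \<and>
        (\<forall>w\<in>S \<inter> U.
           inj_on (\<lambda>i. e i w) {..<k} \<and>
           C2.independent ((\<lambda>i. e i w) ` {..<k}) \<and>
           C2.span ((\<lambda>i. e i w) ` {..<k}) = E w))"

definition splitting_at ::
  "(complex \<times> complex) set \<Rightarrow> (complex \<times> complex) set \<Rightarrow> bool" where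
  "splitting_at Es Eu \<longleftrightarrow>
     C2.subspace Es \<and> C2.subspace Eu \<and>
     Es \<inter> Eu = {0} \<and> {u + v | u v. u \<in> Es \<and> v \<in> Eu} = UNIV"

definition hyperbolic ::
  "(complex \<times> complex \<Rightarrow> complex \<times> complex) \<Rightarrow> (complex \<times> complex) set \<Rightarrow> bool" where
  "hyperbolic f S \<longleftrightarrow>
     diffeomorphism f \<and> compact S \<and> invariant_set f S \<and>
     (\<exists>N Cs Cu ls lu Es Eu.
        is_norm cscale N \<and> Cs > 0 \<and> Cu > 0 \<and> 0 < ls \<and> ls < 1 \<and> 1 < lu \<and>
        (\<forall>z\<in>S. splitting_at (Es z) (Eu z)) \<and>
        continuous_subspaces_on S Es \<and> continuous_subspaces_on S Eu \<and>
        (\<forall>z\<in>S. frechet_derivative f (at z) ` Es z = Es (f z) \<and>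
               frechet_derivative f (at z) ` Eu z = Eu (f z)) \<and>
        (\<forall>z\<in>S. \<forall>n\<ge>1.
           op_norm_on N (Es z) (frechet_derivative (f ^^ n) (at z)) \<le> Cs * ls ^ n \<and>
           op_norm_on N (Eu z) (frechet_derivative (inv f ^^ n) (at z)) \<le> Cu / lu ^ n))"

(* A point (..., z_{-1}, z_0) is encoded as the sequence k \<mapsto> z_{-k}. The topology is the
   subspace topology of the product topology on nat \<Rightarrow> 'a. *)
definition proj_lim :: "'a set \<Rightarrow> ('a \<Rightarrow> 'a) \<Rightarrow> (nat \<Rightarrow> 'a) set" where
  "proj_lim S f = {z. (\<forall>k. z k \<in> S) \<and> (\<forall>k. f (z (Suc k)) = z k)}"

definition shift_map :: "('a \<Rightarrow> 'a) \<Rightarrow> (nat \<Rightarrow> 'a) \<Rightarrow> nat \<Rightarrow> 'a" where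
  "shift_map f z = case_nat (f (z 0)) z"

definition quad :: "complex \<Rightarrow> complex \<Rightarrow> complex" where
  "quad c x = x\<^sup>2 + c"

definition henon :: "complex \<Rightarrow> complex \<Rightarrow> complex \<times> complex \<Rightarrow> complex \<times> complex" where
  "henon c b = (\<lambda>(x, y). (x\<^sup>2 + c - b * y, x))"

end

theory Submission
  imports Defs
begin

text \<open>
  For $b \ne 0$ a point $(x_1, x_0)$ determines its whole Henon orbit, and this orbit is the
  same thing as a bi-infinite sequence with $x_{n+1} = x_n^2 + c - b x_{n-1}$. For $b = 0$ such
  sequences are the full orbits $\xi$ of $q$, and those inside $\Lambda$ are the points of the
  inverse limit. So the theorem says that every full orbit in $\Lambda$ persists as a nearby
  solution of the perturbed recursion, uniquely, and that the resulting point set is hyperbolic.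

  Persistence: writing $x = \xi + u$, the recursion becomes
  $2 \xi_n u_n - u_{n+1} = b x_{n-1} - u_n^2$. Expansion makes the left hand side, as an
  operator on bounded sequences, invertible with inverse bounded by $1 / (C (l - 1))$,
  where $C\, l^k$ bounds the derivatives of the iterates from below
  (lemmas expanding_recursion_solution and expanding_recursion_bound), so a contraction in the
  supremum norm yields exactly one solution with $|u| \le r$. The same a priori bound shows that
  two full orbits in $\Lambda$ that stay close coincide, so $x$ also determines $\xi$. Working
  with the $n$-step expansion in this way avoids an adapted metric.

  Invariant directions: along an orbit $x$, lines spanned by $(t_n, 1)$ are carried to each other
  by the derivative iff $t_n (2 x_n - t_{n+1}) = b$, and lines spanned by $(b, s_n)$ iff
  $s_{n+1} (2 x_n - s_n) = b$. These are one continued fraction equation, read with time running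
  backwards or forwards. As $|2 x_n|$ is bounded below and $b$ is small, it has a unique small
  solution. The first family contracts by the factors $t_n$; the second expands by the factors
  $2 x_n - s_n$, which are relatively close to $2 \xi_n$ and inherit their expansion.

  Topology: the tuples $(\xi, x, t, s)$ form a compact set, being defined by closed conditions on
  bounded sequences. It maps continuously to the inverse limit, by $\xi$, and to the plane, by
  $(x_1, x_0)$, and the uniqueness statements make both maps injective. Continuous injections of
  compact spaces are homeomorphisms onto their images, so the conjugacy, its continuity, that of
  its inverse, and the continuity of the two line fields all follow at once.
\<close>

section \<open>Contractions in the supremum norm\<close>

text \<open>Banach's theorem for families indexed by an arbitrary set. The contraction hypothesis is stated for
pointwise bounds, so that no norm on a space of bounded functions is involved.\<close>

lemma sup_contraction_fixed_point:
  fixes F :: "('i \<Rightarrow> 'a::banach) \<Rightarrow> 'i \<Rightarrow> 'a"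
  assumes r: "0 \<le> r"
    and self: "\<And>u n. (\<And>m. norm (u m) \<le> r) \<Longrightarrow> norm (F u n) \<le> r"
    and contr: "\<And>u v d n. (\<And>m. norm (u m) \<le> r) \<Longrightarrow> (\<And>m. norm (v m) \<le> r) \<Longrightarrow>
                  (\<And>m. norm (u m - v m) \<le> d) \<Longrightarrow> norm (F u n - F v n) \<le> d / 2"
  shows "\<exists>u. (\<forall>n. norm (u n) \<le> r) \<and> F u = u"
proof -
  define w where "w m = (F ^^ m) (\<lambda>_. 0)" for m
  have w_Suc: "w (Suc m) = F (w m)" for m
    by (simp add: w_def)
  have w_le: "norm (w m n) \<le> r" for m n
  proof (induction m arbitrary: n)
    case 0
    show ?case using r by (simp add: w_def)
  next
    case (Suc m)
    then show ?case by (simp add: w_Suc self)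
  qed
  have w_diff: "norm (w (m + k) n - w m n) \<le> 2 * r / 2 ^ m" for m k n
  proof (induction m arbitrary: n)
    case 0
    have "norm (w k n - w 0 n) \<le> r + r"
      using norm_triangle_ineq4[of "w k n" "w 0 n"] w_le[of k n] w_le[of 0 n] by linarith
    then show ?case by simp
  next
    case (Suc m)
    have "norm (F (w (m + k)) n - F (w m) n) \<le> 2 * r / 2 ^ m / 2"
      by (rule contr) (use w_le Suc in auto)
    then show ?case by (simp add: w_Suc)
  qed
  have lim0: "(\<lambda>m. 2 * r / 2 ^ m) \<longlonglongrightarrow> 0"
    using tendsto_mult[OF tendsto_const[of "2 * r"] LIMSEQ_power_zero[of "1 / 2 :: real"]]
    by (simp add: power_one_over)
  have "convergent (\<lambda>m. w m n)" for n
  proof (rule Cauchy_convergent, rule metric_CauchyI)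
    fix e :: real assume "e > 0"
    then obtain M where M: "2 * r / 2 ^ M < e / 2"
      using order_tendstoD(2)[OF lim0, of "e / 2"] by (auto simp: eventually_sequentially)
    have "dist (w m n) (w k n) < e" if "m \<ge> M" "k \<ge> M" for m k
    proof -
      have "dist (w m n) (w M n) < e / 2" "dist (w k n) (w M n) < e / 2"
        using w_diff[of M "m - M" n] w_diff[of M "k - M" n] that M by (auto simp: dist_norm)
      then show ?thesis by (rule dist_triangle_half_l)
    qed
    then show "\<exists>M. \<forall>m\<ge>M. \<forall>k\<ge>M. dist (w m n) (w k n) < e" by blast
  qed
  then obtain u where u: "\<And>n. (\<lambda>m. w m n) \<longlonglongrightarrow> u n"
    unfolding convergent_def by metis
  have u_le: "norm (u n) \<le> r" for n
    by (rule LIMSEQ_le_const2[OF tendsto_norm[OF u]]) (use w_le in auto)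
  have u_diff: "norm (u n - w m n) \<le> 2 * r / 2 ^ m" for m n
  proof (rule LIMSEQ_le_const2)
    show "(\<lambda>k. norm (w (m + k) n - w m n)) \<longlonglongrightarrow> norm (u n - w m n)"
      using LIMSEQ_ignore_initial_segment[OF u, of m n]
      by (intro tendsto_intros) (simp add: add.commute)
  qed (use w_diff in auto)
  have "F u n = u n" for n
  proof (rule LIMSEQ_unique)
    have "norm (w (Suc m) n - F u n) \<le> 2 * r / 2 ^ m" for m
    proof -
      have "norm (F u n - F (w m) n) \<le> 2 * r / 2 ^ m / 2"
        by (rule contr) (use u_le w_le u_diff in auto)
      also have "\<dots> \<le> 2 * r / 2 ^ m" using r by (simp add: divide_right_mono)
      finally show ?thesis by (simp add: w_Suc norm_minus_commute)
    qed
    then have "(\<lambda>m. w (Suc m) n - F u n) \<longlonglongrightarrow> 0"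
      by (intro Lim_null_comparison[OF _ lim0]) auto
    then show "(\<lambda>m. w (Suc m) n) \<longlonglongrightarrow> F u n"
      by (simp add: LIM_zero_iff)
    show "(\<lambda>m. w (Suc m) n) \<longlonglongrightarrow> u n"
      by (rule LIMSEQ_Suc[OF u])
  qed
  with u_le show ?thesis by blast
qed

text \<open>The uniqueness half of the contraction principle, applied to the difference of two fixed points.\<close>

lemma zero_if_bound_halves:
  fixes v :: "'i \<Rightarrow> 'a::real_normed_vector"
  assumes B: "\<And>n. norm (v n) \<le> B"
    and half: "\<And>d n. (\<And>m. norm (v m) \<le> d) \<Longrightarrow> norm (v n) \<le> d / 2"
  shows "v n = 0"
proof -
  have *: "norm (v n) \<le> B * (1 / 2) ^ k" for k n
  proof (induction k arbitrary: n)
    case 0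
    show ?case using B by simp
  next
    case (Suc k)
    from half[OF this] show ?case by simp
  qed
  have "(\<lambda>k. B * (1 / 2) ^ k) \<longlonglongrightarrow> B * 0"
    by (intro tendsto_intros LIMSEQ_power_zero) simp
  then have "norm (v n) \<le> B * 0"
    by (rule LIMSEQ_le_const) (use * in auto)
  then show ?thesis by simp
qed

section \<open>Linear recursions with expanding multipliers\<close>

text \<open>Growth of the products over every block of indices, with a constant \<open>C\<close> that may be small:
single factors need not exceed 1 in modulus.\<close>

definition expanding_multipliers :: "real \<Rightarrow> real \<Rightarrow> (int \<Rightarrow> complex) \<Rightarrow> bool" where
  "expanding_multipliers C l a \<longleftrightarrow> (\<forall>n. \<forall>k\<ge>1. C * l ^ k \<le> cmod (\<Prod>j<k. a (n + int j)))"

lemma prod_Suc_shift: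
  fixes a :: "int \<Rightarrow> complex"
  shows "(\<Prod>j<Suc k. a (n + int j)) = a n * (\<Prod>j<k. a (n + 1 + int j))"
  unfolding prod.lessThan_Suc_shift by (simp add: algebra_simps)

lemma geometric_bound_sums:
  assumes "C > 0" "(l::real) > 1"
  shows "(\<lambda>k. M / (C * l ^ Suc k)) sums (M / (C * (l - 1)))"
proof -
  have "(\<lambda>k. M / (C * l) * (1 / l) ^ k) sums (M / (C * l) * (1 / (1 - 1 / l)))"
    using assms by (intro sums_mult geometric_sums) auto
  moreover have "M / (C * l) * (1 / (1 - 1 / l)) = M / (C * (l - 1))"
    using assms by (simp add: field_simps)
  moreover have "(\<lambda>k. M / (C * l) * (1 / l) ^ k) = (\<lambda>k. M / (C * l ^ Suc k))"
    using assms by (simp add: power_one_over field_simps)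
  ultimately show ?thesis by (simp only:)
qed

text \<open>Solving the recursion for \<open>v n\<close> and iterating \<open>m\<close> times expresses \<open>v n\<close> by \<open>g\<close> with the weights
\<open>1 / (a n \<dots> a (n + k))\<close>, up to a remainder \<open>v (n + m) / (a n \<dots> a (n + m - 1))\<close>. The remainder
tends to 0 because \<open>v\<close> is bounded and the products grow, and the weights are dominated by a geometric series.\<close>

lemma expanding_recursion_bound:
  fixes a g v :: "int \<Rightarrow> complex"
  assumes C: "C > 0" and l: "l > 1" and a: "expanding_multipliers C l a"
    and v: "\<And>n. cmod (v n) \<le> B"
    and rec: "\<And>n. a n * v n = v (n + 1) + g n"
    and g: "\<And>n. cmod (g n) \<le> M"
  shows "cmod (v n) \<le> M / (C * (l - 1))"
proof -
  define P where "P k n = (\<Prod>j<k. a (n + int j))" for k n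
  have P_ge: "C * l ^ Suc k \<le> cmod (P (Suc k) n)" for k n
    using a unfolding expanding_multipliers_def P_def
    by (simp del: power_Suc prod.lessThan_Suc)
  have P_pos: "C * l ^ Suc k > 0" for k
    using C l by simp
  have P_nz: "P k n \<noteq> 0" for k n
  proof (cases k)
    case (Suc m)
    then show ?thesis using P_ge[of m n] P_pos[of m] by auto
  qed (simp add: P_def)
  have P_step: "P (Suc k) n = P k n * a (n + int k)" for k n
    by (simp add: P_def)
  have expand: "v n = (\<Sum>k<m. g (n + int k) / P (Suc k) n) + v (n + int m) / P m n" for m
  proof (induction m)
    case 0
    show ?case by (simp add: P_def)
  next
    case (Suc m)
    have nz: "a (n + int m) \<noteq> 0"
      using P_nz[of "Suc m" n] by (auto simp: P_step)
    have "v (n + int m) = (v (n + int m + 1) + g (n + int m)) / a (n + int m)"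
      using rec[of "n + int m"] nz by (simp add: field_simps)
    then have "v (n + int m) / P m n
        = g (n + int m) / P (Suc m) n + v (n + int (Suc m)) / P (Suc m) n"
      using nz P_nz[of m n] by (simp add: P_step field_simps)
    then show ?case using Suc by simp
  qed
  have bound: "cmod (v n) \<le> M / (C * (l - 1)) + B / (C * l ^ Suc m)" for m
  proof -
    have M: "0 \<le> M" using order_trans[OF norm_ge_zero g] .
    have term_le: "cmod (z / P (Suc k) n) \<le> D / (C * l ^ Suc k)" if "cmod z \<le> D" for z D k
      unfolding norm_divide
      by (rule frac_le) (use that P_ge P_pos order_trans[OF norm_ge_zero that] in auto)
    have "cmod (v n) \<le> cmod (\<Sum>k<Suc m. g (n + int k) / P (Suc k) n) + cmod (v (n + int (Suc m)) / P (Suc m) n)"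
      by (subst expand[of "Suc m"]) (rule norm_triangle_ineq)
    also have "\<dots> \<le> (\<Sum>k<Suc m. M / (C * l ^ Suc k)) + B / (C * l ^ Suc m)"
      by (intro add_mono order_trans[OF norm_sum] sum_mono term_le g v)
    also have "(\<Sum>k<Suc m. M / (C * l ^ Suc k)) \<le> M / (C * (l - 1))"
    proof (rule sum_le_suminf[THEN order_trans])
      show "summable (\<lambda>k. M / (C * l ^ Suc k))"
        by (rule sums_summable[OF geometric_bound_sums[OF C l]])
      show "0 \<le> M / (C * l ^ Suc k)" for k
        using M P_pos[of k] by simp
      show "(\<Sum>k. M / (C * l ^ Suc k)) \<le> M / (C * (l - 1))"
        using sums_unique[OF geometric_bound_sums[OF C l, of M]] by simp
    qed simp
    finally show ?thesis by simp
  qed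
  have "(\<lambda>m. B / (C * l ^ Suc m)) \<longlonglongrightarrow> 0"
    by (rule summable_LIMSEQ_zero[OF sums_summable[OF geometric_bound_sums[OF C l]]])
  then have "(\<lambda>m. M / (C * (l - 1)) + B / (C * l ^ Suc m)) \<longlonglongrightarrow> M / (C * (l - 1)) + 0"
    by (intro tendsto_intros)
  then show ?thesis
    using LIMSEQ_le_const[of _ "M / (C * (l - 1)) + 0" "cmod (v n)"] bound by auto
qed

text \<open>The series to which the iteration in the previous proof converges solves the recursion. The
solution is produced as an operator \<open>G\<close> on the right hand sides, in the form in which the
fixed-point argument needs it.\<close>

lemma expanding_recursion_solution:
  fixes a :: "int \<Rightarrow> complex"
  assumes C: "C > 0" and l: "l > 1" and a: "expanding_multipliers C l a"
  obtains G where
    "\<And>g M. (\<And>n. cmod (g n) \<le> M) \<Longrightarrow>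
       (\<forall>n. a n * G g n = G g (n + 1) + g n) \<and> (\<forall>n. cmod (G g n) \<le> M / (C * (l - 1)))"
proof -
  define P where "P k n = (\<Prod>j<k. a (n + int j))" for k n
  have P_ge: "C * l ^ Suc k \<le> cmod (P (Suc k) n)" for k n
    using a unfolding expanding_multipliers_def P_def
    by (simp del: power_Suc prod.lessThan_Suc)
  have P_pos: "C * l ^ Suc k > 0" for k
    using C l by simp
  have P_step: "P (Suc k) n = a n * P k (n + 1)" for k n
    unfolding P_def by (rule prod_Suc_shift)
  have a_nz: "a n \<noteq> 0" for n
    using P_ge[of 0 n] P_pos[of 0] by (auto simp: P_def)
  define G where "G g n = (\<Sum>k. g (n + int k) / P (Suc k) n)" for g n
  have "(\<forall>n. a n * G g n = G g (n + 1) + g n) \<and> (\<forall>n. cmod (G g n) \<le> M / (C * (l - 1)))"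
    if g: "\<And>n. cmod (g n) \<le> M" for g M
  proof -
    have term_le: "cmod (g (n + int k) / P (Suc k) n) \<le> M / (C * l ^ Suc k)" for k n
      unfolding norm_divide
      by (rule frac_le) (use g P_ge P_pos order_trans[OF norm_ge_zero g] in auto)
    have sg: "summable (\<lambda>k. M / (C * l ^ Suc k))"
      by (rule sums_summable[OF geometric_bound_sums[OF C l]])
    have sm: "summable (\<lambda>k. g (n + int k) / P (Suc k) n)" for n
      by (rule summable_comparison_test'[OF sg]) (use term_le in auto)
    have "cmod (G g n) \<le> M / (C * (l - 1))" for n
    proof -
      have "cmod (G g n) \<le> (\<Sum>k. M / (C * l ^ Suc k))"
        unfolding G_def by (rule norm_suminf_le[OF term_le sg])
      then show ?thesis using sums_unique[OF geometric_bound_sums[OF C l, of M]] by simp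
    qed
    moreover have "a n * G g n = G g (n + 1) + g n" for n
    proof -
      have eq: "a n * (g (n + int (Suc k)) / P (Suc (Suc k)) n) = g (n + 1 + int k) / P (Suc k) (n + 1)" for k
        using a_nz[of n] by (simp add: P_step[of "Suc k" n] algebra_simps)
      have "a n * G g n = (\<Sum>k. a n * (g (n + int k) / P (Suc k) n))"
        unfolding G_def by (rule suminf_mult[OF sm, symmetric])
      also have "\<dots> = (\<Sum>k. a n * (g (n + int (Suc k)) / P (Suc (Suc k)) n)) + a n * (g (n + int 0) / P (Suc 0) n)"
        using suminf_split_head[OF summable_mult[OF sm, of "a n" n]] by simp
      also have "\<dots> = G g (n + 1) + g n"
        using a_nz[of n] by (simp only: eq G_def) (simp add: P_def)
      finally show ?thesis .
    qed
    ultimately show ?thesis by blast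
  qed
  then show ?thesis using that by blast
qed

section \<open>Continued fractions along an orbit\<close>

text \<open>On sequences bounded by \<open>d / 2\<close>, all denominators of \<open>b / (a n - \<tau> (\<phi> n))\<close> are at least \<open>d / 2\<close> in
modulus. The map therefore stays in this ball and halves distances when \<open>\<bar>b\<bar> \<le> d\<^sup>2 / 8\<close>. The index
map \<open>\<phi>\<close> will be a shift by one, in either direction of time.\<close>

lemma continued_fraction_exists:
  fixes a :: "'i \<Rightarrow> complex" and \<phi> :: "'i \<Rightarrow> 'i"
  assumes d: "d > 0" and a: "\<And>n. d \<le> cmod (a n)" and b: "cmod b \<le> d\<^sup>2 / 8"
  obtains \<tau> where "\<And>n. cmod (\<tau> n) \<le> d / 2" "\<And>n. \<tau> n * (a n - \<tau> (\<phi> n)) = b"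
proof -
  define F where "F u n = b / (a n - u (\<phi> n))" for u n
  have den: "d / 2 \<le> cmod (a n - u (\<phi> n))" if "\<And>m. cmod (u m) \<le> d / 2" for u n
    using norm_triangle_ineq2[of "a n" "u (\<phi> n)"] a[of n] that[of "\<phi> n"] by linarith
  have "\<exists>u. (\<forall>n. norm (u n) \<le> d / 2) \<and> F u = u"
  proof (rule sup_contraction_fixed_point)
    fix u :: "'i \<Rightarrow> complex" and n assume u: "\<And>m. norm (u m) \<le> d / 2"
    have "norm (F u n) \<le> (d\<^sup>2 / 8) / (d / 2)"
      unfolding F_def norm_divide by (rule frac_le) (use b den[OF u] d in auto)
    also have "\<dots> \<le> d / 2" using d by (simp add: field_simps power2_eq_square)
    finally show "norm (F u n) \<le> d / 2" .
  next
    fix u v :: "'i \<Rightarrow> complex" and e :: real and n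
    assume u: "\<And>m. norm (u m) \<le> d / 2" and v: "\<And>m. norm (v m) \<le> d / 2"
      and e: "\<And>m. norm (u m - v m) \<le> e"
    let ?p = "a n - u (\<phi> n)" and ?q = "a n - v (\<phi> n)"
    have den': "d / 2 \<le> cmod ?p" "d / 2 \<le> cmod ?q" using den u v by auto
    then have nz: "?p \<noteq> 0" "?q \<noteq> 0" using d by (auto simp del: right_minus_eq)
    have "F u n - F v n = b * (u (\<phi> n) - v (\<phi> n)) / (?p * ?q)"
      using nz unfolding F_def by (simp add: field_simps)
    then have "norm (F u n - F v n) = cmod b * cmod (u (\<phi> n) - v (\<phi> n)) / (cmod ?p * cmod ?q)"
      by (simp add: norm_mult norm_divide)
    also have "\<dots> \<le> (d\<^sup>2 / 8 * e) / (d / 2 * (d / 2))"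
      using b e[of "\<phi> n"] den' d order_trans[OF norm_ge_zero e]
      by (intro frac_le mult_mono) auto
    also have "\<dots> = e / 2" using d by (simp add: field_simps power2_eq_square)
    finally show "norm (F u n - F v n) \<le> e / 2" .
  qed (use d in simp)
  then obtain u where u: "\<And>n. cmod (u n) \<le> d / 2" "F u = u" by auto
  have "u n * (a n - u (\<phi> n)) = b" for n
  proof -
    have "d / 2 \<le> cmod (a n - u (\<phi> n))" using den u(1) by blast
    then have "a n - u (\<phi> n) \<noteq> 0" using d by (auto simp del: right_minus_eq)
    then show ?thesis
      using fun_cong[OF u(2), of n] unfolding F_def by (metis nonzero_eq_divide_eq)
  qed
  then show ?thesis using that u(1) by blast
qed

lemma continued_fraction_unique:
  fixes a :: "'i \<Rightarrow> complex" and \<phi> :: "'i \<Rightarrow> 'i"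
  assumes d: "d > 0" and a: "\<And>n. d \<le> cmod (a n)" and b: "cmod b \<le> d\<^sup>2 / 8"
    and s: "\<And>n. cmod (s n) \<le> d / 2" "\<And>n. s n * (a n - s (\<phi> n)) = b"
    and t: "\<And>n. cmod (t n) \<le> d / 2" "\<And>n. t n * (a n - t (\<phi> n)) = b"
  shows "s = t"
proof -
  have "s n - t n = 0" for n
  proof (rule zero_if_bound_halves[where v = "\<lambda>n. s n - t n" and B = d])
    show "norm (s n - t n) \<le> d" for n
      using norm_triangle_ineq4[of "s n" "t n"] s(1)[of n] t(1)[of n] by linarith
  next
    fix e n assume e: "\<And>m. norm (s m - t m) \<le> e"
    let ?p = "a n - s (\<phi> n)" and ?q = "a n - t (\<phi> n)"
    have den: "d / 2 \<le> cmod ?p" "d / 2 \<le> cmod ?q"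
      using norm_triangle_ineq2[of "a n" "s (\<phi> n)"] norm_triangle_ineq2[of "a n" "t (\<phi> n)"]
        a[of n] s(1)[of "\<phi> n"] t(1)[of "\<phi> n"] by linarith+
    then have nz: "?p \<noteq> 0" "?q \<noteq> 0" using d by (auto simp del: right_minus_eq)
    have "s n = b / ?p" "t n = b / ?q"
      using s(2)[of n] t(2)[of n] nz by (metis nonzero_mult_div_cancel_right)+
    then have "s n - t n = b / ?p - b / ?q" by (simp only:)
    also have "\<dots> = b * (s (\<phi> n) - t (\<phi> n)) / (?p * ?q)"
      using nz by (simp add: field_simps)
    finally have "s n - t n = b * (s (\<phi> n) - t (\<phi> n)) / (?p * ?q)" .
    then have "norm (s n - t n) = cmod b * cmod (s (\<phi> n) - t (\<phi> n)) / (cmod ?p * cmod ?q)"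
      by (simp add: norm_mult norm_divide)
    also have "\<dots> \<le> (d\<^sup>2 / 8 * e) / (d / 2 * (d / 2))"
      using b e[of "\<phi> n"] den d order_trans[OF norm_ge_zero e]
      by (intro frac_le mult_mono) auto
    also have "\<dots> = e / 2" using d by (simp add: field_simps power2_eq_square)
    finally show "norm (s n - t n) \<le> e / 2" .
  qed
  then show ?thesis by auto
qed

section \<open>Compact products, derivatives of iterates and line fields\<close>

text \<open>Tychonoff's theorem in terms of the topology on function types.\<close>

lemma compact_sequences:
  fixes K :: "'a::topological_space set"
  assumes "compact K"
  shows "compact {f :: 'i \<Rightarrow> 'a. \<forall>n. f n \<in> K}"
proof -
  have "compactin (product_topology (\<lambda>_. euclidean) (UNIV :: 'i set)) (PiE UNIV (\<lambda>_. K))"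
    using assms by (subst compactin_PiE) auto
  moreover have "PiE UNIV (\<lambda>_. K) = {f :: 'i \<Rightarrow> 'a. \<forall>n. f n \<in> K}"
    by (auto simp: PiE_def)
  ultimately show ?thesis by (simp add: euclidean_product_topology)
qed

text \<open>The chain rule along an orbit: \<open>D\<close> is applied at \<open>z\<close>, then at \<open>f z\<close>, and so on. Peeling off the first
factor, rather than the last, matches inductions that shift the starting point along the orbit.\<close>

fun iterate_derivative :: "('v \<Rightarrow> 'v) \<Rightarrow> ('v \<Rightarrow> 'v \<Rightarrow> 'v) \<Rightarrow> nat \<Rightarrow> 'v \<Rightarrow> 'v \<Rightarrow> 'v" where
  "iterate_derivative f D 0 z v = v"
| "iterate_derivative f D (Suc n) z v = iterate_derivative f D n (f z) (D z v)"

lemma funpow_has_derivative: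
  fixes f :: "'v::real_normed_vector \<Rightarrow> 'v"
  assumes "\<And>z. (f has_derivative D z) (at z)"
  shows "((f ^^ n) has_derivative iterate_derivative f D n z) (at z)"
proof (induction n arbitrary: z)
  case 0
  have "iterate_derivative f D 0 z = (\<lambda>v. v)" by auto
  then show ?case by (simp add: id_def)
next
  case (Suc n)
  have "((f ^^ n) \<circ> f has_derivative iterate_derivative f D n (f z) \<circ> D z) (at z)"
    by (rule diff_chain_at[OF assms Suc])
  moreover have "iterate_derivative f D (Suc n) z = iterate_derivative f D n (f z) \<circ> D z"
    by auto
  ultimately show ?case by (simp only: funpow_Suc_right)
qed

lemma frechet_derivative_funpow:
  fixes f :: "'v::euclidean_space \<Rightarrow> 'v"
  assumes "\<And>z. (f has_derivative D z) (at z)"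
  shows "frechet_derivative (f ^^ n) (at z) = iterate_derivative f D n z"
  by (rule frechet_derivative_at[symmetric, OF funpow_has_derivative[OF assms]])

text \<open>Vectors with \<open>N v = 0\<close> contribute \<open>_ / 0 = 0\<close> to the supremum, which is why \<open>B\<close> has to be nonnegative.\<close>

lemma op_norm_on_le:
  assumes "E \<noteq> {}" "0 \<le> B" "\<And>v. 0 \<le> N v" "\<And>v. v \<in> E \<Longrightarrow> N (A v) \<le> B * N v"
  shows "op_norm_on N E A \<le> B"
  unfolding op_norm_on_def
proof (rule cSUP_least[OF assms(1)])
  fix v assume "v \<in> E"
  then show "N (A v) / N v \<le> B"
    using assms(2,4) assms(3)[of v] by (cases "N v = 0") (auto simp: divide_le_eq)
qed

text \<open>A nowhere vanishing continuous section of a field of lines is a frame on the whole set.\<close>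

lemma continuous_subspaces_on_lines:
  assumes "continuous_on S e" "\<And>z. z \<in> S \<Longrightarrow> e z \<noteq> 0"
    and "\<And>z. z \<in> S \<Longrightarrow> E z = range (\<lambda>h. cscale h (e z))"
  shows "continuous_subspaces_on S E"
  unfolding continuous_subspaces_on_def
proof
  fix z assume "z \<in> S"
  have "{..<1::nat} = {0}" by auto
  then show "\<exists>U k e. open U \<and> z \<in> U \<and> (\<forall>i<(k::nat). continuous_on (S \<inter> U) (e i)) \<and>
        (\<forall>w\<in>S \<inter> U. inj_on (\<lambda>i. e i w) {..<k} \<and> C2.independent ((\<lambda>i. e i w) ` {..<k}) \<and>
           C2.span ((\<lambda>i. e i w) ` {..<k}) = E w)"
    using assms by (intro exI[of _ UNIV] exI[of _ 1] exI[of _ "\<lambda>_. e"])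
      (auto simp: C2.span_singleton)
qed

text \<open>In this norm \<open>(t, 1)\<close> has length 1 whenever \<open>\<bar>t\<bar> \<le> 1\<close>, so along the stable directions the derivative
contracts at every step, with no constant in front.\<close>

definition max_norm :: "complex \<times> complex \<Rightarrow> real" where
  "max_norm v = max (cmod (fst v)) (cmod (snd v))"

lemma is_norm_max_norm: "is_norm cscale max_norm"
proof -
  have "max_norm v = 0 \<longleftrightarrow> v = 0" for v
    by (cases v) (auto simp: max_norm_def max_def zero_prod_def split: if_splits)
  moreover have "max_norm (cscale a v) = cmod a * max_norm v" for a v
    by (simp add: max_norm_def cscale_def norm_mult max_mult_distrib_left)
  moreover have "max_norm (u + v) \<le> max_norm u + max_norm v" for u v
  proof -
    have "cmod (fst u + fst v) \<le> max_norm u + max_norm v"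
      by (rule order_trans[OF norm_triangle_ineq]) (simp add: max_norm_def add_mono)
    moreover have "cmod (snd u + snd v) \<le> max_norm u + max_norm v"
      by (rule order_trans[OF norm_triangle_ineq]) (simp add: max_norm_def add_mono)
    ultimately show ?thesis by (simp add: max_norm_def[of "u + v"])
  qed
  moreover have "0 \<le> max_norm v" for v by (simp add: max_norm_def le_max_iff_disj)
  ultimately show ?thesis by (simp add: is_norm_def)
qed

lemma max_norm_cscale: "max_norm (cscale a v) = cmod a * max_norm v"
  using is_norm_max_norm unfolding is_norm_def by blast

lemma max_norm_nonneg: "0 \<le> max_norm v"
  by (simp add: max_norm_def le_max_iff_disj)

text \<open>The determinant of the two spanning vectors is nonzero, so Cramer's rule gives the components.\<close>

lemma splitting_at_lines:
  assumes "fst u * snd v \<noteq> fst v * snd u"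
  shows "splitting_at (range (\<lambda>h. cscale h u)) (range (\<lambda>h. cscale h v))"
proof -
  obtain t s where u: "u = (t, s)" by (cases u)
  obtain p q where v: "v = (p, q)" by (cases v)
  have det: "t * q - p * s \<noteq> 0" using assms by (simp add: u v)
  have sub: "C2.subspace (range (\<lambda>h. cscale h w))" for w
    using C2.subspace_span[of "{w}"] by (simp add: C2.span_singleton)
  have "w \<in> {y + z |y z. y \<in> range (\<lambda>h. cscale h u) \<and> z \<in> range (\<lambda>h. cscale h v)}" for w
  proof -
    obtain x y where w: "w = (x, y)" by (cases w)
    let ?\<alpha> = "(x * q - p * y) / (t * q - p * s)" and ?\<beta> = "(t * y - x * s) / (t * q - p * s)"
    have "?\<alpha> * t + ?\<beta> * p = x" "?\<alpha> * s + ?\<beta> * q = y"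
    proof -
      have "?\<alpha> * t + ?\<beta> * p = x * (t * q - p * s) / (t * q - p * s)"
        unfolding times_divide_eq_left add_divide_distrib[symmetric] by (simp add: algebra_simps)
      then show "?\<alpha> * t + ?\<beta> * p = x" using det by simp
      have "?\<alpha> * s + ?\<beta> * q = y * (t * q - p * s) / (t * q - p * s)"
        unfolding times_divide_eq_left add_divide_distrib[symmetric] by (simp add: algebra_simps)
      then show "?\<alpha> * s + ?\<beta> * q = y" using det by simp
    qed
    then have "w = cscale ?\<alpha> u + cscale ?\<beta> v" by (simp add: w u v cscale_def)
    then show ?thesis by blast
  qed
  moreover have "w = 0" if w: "w \<in> range (\<lambda>h. cscale h u)" "w \<in> range (\<lambda>h. cscale h v)" for w
  proof -
    obtain g h where gh: "w = cscale g u" "w = cscale h v" using w by blast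
    have e: "g * t = h * p" "g * s = h * q" using gh by (auto simp: cscale_def u v)
    have "g * (t * q - p * s) = (g * t) * q - p * (g * s)" by (simp add: algebra_simps)
    also have "\<dots> = 0" by (simp add: e)
    finally show ?thesis using det gh(1) by (simp add: cscale_def zero_prod_def)
  qed
  moreover have "0 \<in> range (\<lambda>h. cscale h w)" for w
    using C2.subspace_0[OF sub] .
  ultimately show ?thesis
    unfolding splitting_at_def using sub by blast
qed

lemma range_cscale_mult:
  assumes "m \<noteq> 0"
  shows "range (\<lambda>h. cscale (h * m) v) = range (\<lambda>h. cscale h v)"
proof (intro equalityI subsetI)
  fix w assume "w \<in> range (\<lambda>h. cscale h v)"
  then obtain h where "w = cscale h v" by auto
  then have "w = cscale (h / m * m) v" using assms by simp
  then show "w \<in> range (\<lambda>h. cscale (h * m) v)" by blast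
qed auto

section \<open>The Henon map and its inverse\<close>

definition henon_inv :: "complex \<Rightarrow> complex \<Rightarrow> complex \<times> complex \<Rightarrow> complex \<times> complex" where
  "henon_inv c b = (\<lambda>(x, y). (y, (y\<^sup>2 + c - x) / b))"

definition henon_deriv :: "complex \<Rightarrow> complex \<times> complex \<Rightarrow> complex \<times> complex \<Rightarrow> complex \<times> complex" where
  "henon_deriv b z v = (2 * fst z * fst v - b * snd v, fst v)"

definition henon_inv_deriv :: "complex \<Rightarrow> complex \<times> complex \<Rightarrow> complex \<times> complex \<Rightarrow> complex \<times> complex" where
  "henon_inv_deriv b z v = (snd v, (2 * snd z * snd v - fst v) / b)"

lemma henon_has_derivative: "(henon c b has_derivative henon_deriv b z) (at z)"
  unfolding henon_def henon_deriv_def case_prod_beta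
  by (auto intro!: derivative_eq_intros simp: algebra_simps)

lemma henon_inv_has_derivative:
  "b \<noteq> 0 \<Longrightarrow> (henon_inv c b has_derivative henon_inv_deriv b z) (at z)"
  unfolding henon_inv_def henon_inv_deriv_def case_prod_beta
  by (auto intro!: derivative_eq_intros simp: field_simps)

lemma henon_inv_henon: "b \<noteq> 0 \<Longrightarrow> henon_inv c b (henon c b z) = z"
  by (cases z) (simp add: henon_def henon_inv_def)

lemma henon_henon_inv: "b \<noteq> 0 \<Longrightarrow> henon c b (henon_inv c b z) = z"
  by (cases z) (simp add: henon_def henon_inv_def)

lemma bij_henon: "b \<noteq> 0 \<Longrightarrow> bij (henon c b)"
  by (rule o_bij[of "henon_inv c b"]) (auto simp: henon_inv_henon henon_henon_inv)

lemma inv_henon: "b \<noteq> 0 \<Longrightarrow> inv (henon c b) = henon_inv c b"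
  by (rule inv_equality) (auto simp: henon_inv_henon henon_henon_inv)

lemma diffeomorphism_henon:
  assumes b: "b \<noteq> 0"
  shows "diffeomorphism (henon c b)"
proof -
  have "C1_map (henon c b)"
    unfolding C1_map_def
  proof (intro conjI allI)
    show "henon c b differentiable_on UNIV"
      unfolding differentiable_on_def differentiable_def using henon_has_derivative by blast
    show "continuous_on UNIV (\<lambda>z. frechet_derivative (henon c b) (at z) v)" for v
      unfolding frechet_derivative_at[OF henon_has_derivative, symmetric] henon_deriv_def
      by (intro continuous_intros)
  qed
  moreover have "C1_map (henon_inv c b)"
    unfolding C1_map_def
  proof (intro conjI allI)
    show "henon_inv c b differentiable_on UNIV"
      unfolding differentiable_on_def differentiable_def
      using henon_inv_has_derivative[OF b] by blast
    show "continuous_on UNIV (\<lambda>z. frechet_derivative (henon_inv c b) (at z) v)" for v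
      unfolding frechet_derivative_at[OF henon_inv_has_derivative[OF b], symmetric] henon_inv_deriv_def
      using b by (intro continuous_intros) auto
  qed
  ultimately show ?thesis
    using b by (simp add: diffeomorphism_def bij_henon inv_henon)
qed

section \<open>Full orbits of an expanding quadratic map\<close>

text \<open>The data extracted from an expanding compact invariant set: \<open>\<Prod>j<k. 2 * (quad c ^^ j) z\<close> is the
derivative of the \<open>k\<close>-th iterate of the quadratic map at \<open>z\<close>.\<close>

locale expanding_quad =
  fixes c :: complex and \<Lambda> :: "complex set" and C l R :: real
  assumes compact_base: "compact \<Lambda>"
    and forward_invariant: "\<And>z. z \<in> \<Lambda> \<Longrightarrow> quad c z \<in> \<Lambda>"
    and base_bound: "\<And>z. z \<in> \<Lambda> \<Longrightarrow> cmod z \<le> R"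
    and C_pos: "C > 0" and l_gt_1: "l > 1"
    and expansion: "\<And>z k. z \<in> \<Lambda> \<Longrightarrow> k \<ge> 1 \<Longrightarrow>
           C * l ^ k \<le> cmod (\<Prod>j<k. 2 * (quad c ^^ j) z)"
begin

text \<open>The shadowing radius. The choice makes the bound \<open>1 / (C * (l - 1))\<close> for the inverse of the
linearised recursion equal to \<open>1 / (8 * r)\<close>, so that the quadratic term, with Lipschitz constant
\<open>2 * r\<close> on the ball of radius \<open>r\<close>, contributes only 1/4 to the contraction factor.\<close>

definition r :: real where "r = C * (l - 1) / 8"

text \<open>Half of the lower bound \<open>C * l\<close> of \<open>cmod (2 * z)\<close> on \<open>\<Lambda>\<close>; it still bounds \<open>cmod (2 * x n)\<close> from
below along shadowing orbits.\<close>

definition \<delta> :: real where "\<delta> = C * l / 2"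

lemma r_pos: "r > 0" and \<delta>_pos: "\<delta> > 0" and r_le_\<delta>: "r \<le> \<delta> / 4"
  using C_pos l_gt_1 by (auto simp: r_def \<delta>_def field_simps)

lemma gap_eq: "C * (l - 1) = 8 * r"
  by (simp add: r_def)

definition full_orbits :: "(int \<Rightarrow> complex) set" where
  "full_orbits = {\<xi>. \<forall>n. \<xi> n \<in> \<Lambda> \<and> \<xi> (n + 1) = quad c (\<xi> n)}"

lemma full_orbitsD:
  assumes "\<xi> \<in> full_orbits"
  shows "\<xi> n \<in> \<Lambda>" "\<xi> (n + 1) = quad c (\<xi> n)" "cmod (\<xi> n) \<le> R"
  using assms base_bound by (auto simp: full_orbits_def)

lemma full_orbit_iterate:
  assumes "\<xi> \<in> full_orbits"
  shows "\<xi> (n + int j) = (quad c ^^ j) (\<xi> n)"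
proof (induction j)
  case (Suc j)
  have "\<xi> (n + int (Suc j)) = \<xi> (n + int j + 1)" by (simp add: algebra_simps)
  also have "\<dots> = quad c (\<xi> (n + int j))" by (rule full_orbitsD(2)[OF assms])
  finally show ?case using Suc by simp
qed simp

lemma full_orbit_multipliers:
  assumes "\<xi> \<in> full_orbits"
  shows "expanding_multipliers C l (\<lambda>n. 2 * \<xi> n)"
  unfolding expanding_multipliers_def
  using expansion[OF full_orbitsD(1)[OF assms]] by (simp add: full_orbit_iterate[OF assms])

lemma full_orbit_away_from_0:
  assumes "\<xi> \<in> full_orbits"
  shows "2 * \<delta> \<le> cmod (2 * \<xi> n)"
  using expansion[OF full_orbitsD(1)[OF assms], of 1 n] by (simp add: \<delta>_def)

text \<open>The difference \<open>w\<close> of two orbits satisfies \<open>2 \<xi> w = w (n + 1) - w\<^sup>2\<close>; if \<open>w\<close> is small, the a priori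
bound for the linear part makes \<open>w\<close> at most a fraction of its own supremum.\<close>

lemma full_orbits_expansive:
  assumes \<xi>: "\<xi> \<in> full_orbits" and \<xi>': "\<xi>' \<in> full_orbits"
    and close: "\<And>n. cmod (\<xi>' n - \<xi> n) \<le> 2 * r"
  shows "\<xi>' = \<xi>"
proof -
  define w where "w n = \<xi>' n - \<xi> n" for n
  have rec: "2 * \<xi> n * w n = w (n + 1) + - (w n)\<^sup>2" for n
    using full_orbitsD(2)[OF \<xi>, of n] full_orbitsD(2)[OF \<xi>', of n]
    by (simp add: w_def quad_def power2_eq_square algebra_simps)
  have "w n = 0" for n
  proof (rule zero_if_bound_halves[where v = w and B = "2 * r"])
    show "norm (w n) \<le> 2 * r" for n using close by (simp add: w_def)
  next
    fix d n assume d: "\<And>m. norm (w m) \<le> d"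
    have g: "cmod (- (w m)\<^sup>2) \<le> 2 * r * d" for m
      unfolding norm_minus_cancel power2_eq_square norm_mult
      by (rule mult_mono) (use close d r_pos in \<open>auto simp: w_def\<close>)
    have "cmod (w n) \<le> (2 * r * d) / (C * (l - 1))"
      by (rule expanding_recursion_bound[OF C_pos l_gt_1 full_orbit_multipliers[OF \<xi>] d rec g])
    also have "\<dots> \<le> d / 2"
      using r_pos order_trans[OF norm_ge_zero d] by (simp add: gap_eq)
    finally show "norm (w n) \<le> d / 2" .
  qed
  then show ?thesis by (auto simp: w_def)
qed

end

section \<open>Shadowing by Henon orbits\<close>

text \<open>The first two bounds on \<open>b\<close> serve the shadowing contraction: the first for its Lipschitz constant,
both for mapping the ball of radius \<open>r\<close> into itself. The third makes the continued fractions contract and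
keeps the unstable slopes so small that the expansion is not lost, and the fourth makes the stable slopes at most 1/2.\<close>

locale henon_perturbation = expanding_quad +
  fixes b :: complex
  assumes b_nz: "b \<noteq> 0"
    and b_le: "cmod b \<le> 2 * r" "cmod b * R \<le> 4 * r\<^sup>2" "cmod b \<le> r * \<delta> / 2" "cmod b \<le> \<delta> / 4"
begin

lemma b_le_\<delta>_squared: "cmod b \<le> \<delta>\<^sup>2 / 8"
proof -
  have "r * \<delta> \<le> \<delta> / 4 * \<delta>" using r_le_\<delta> \<delta>_pos by (intro mult_right_mono) auto
  then show ?thesis using b_le(3) by (simp add: power2_eq_square)
qed

text \<open>For a correction \<open>u\<close> with \<open>x = \<xi> + u\<close>, the Henon recursion for \<open>x\<close> reads
\<open>2 \<xi> u = u (n + 1) + forcing \<xi> u\<close>.\<close>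

definition forcing :: "(int \<Rightarrow> complex) \<Rightarrow> (int \<Rightarrow> complex) \<Rightarrow> int \<Rightarrow> complex" where
  "forcing \<xi> u n = b * (\<xi> (n - 1) + u (n - 1)) - (u n)\<^sup>2"

lemma forcing_bound:
  assumes \<xi>: "\<xi> \<in> full_orbits" and u: "\<And>n. cmod (u n) \<le> r"
  shows "cmod (forcing \<xi> u n) \<le> 8 * r\<^sup>2"
proof -
  have "cmod (b * \<xi> (n - 1)) \<le> cmod b * R"
    unfolding norm_mult by (intro mult_left_mono full_orbitsD(3)[OF \<xi>]) auto
  moreover have "cmod (b * u (n - 1)) \<le> 2 * r\<^sup>2"
    unfolding norm_mult power2_eq_square mult.assoc[symmetric] by (intro mult_mono b_le u) (use r_pos in auto)
  moreover have "cmod ((u n)\<^sup>2) \<le> r\<^sup>2"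
    unfolding norm_power by (intro power_mono u) auto
  moreover have "cmod (forcing \<xi> u n) \<le> cmod (b * \<xi> (n - 1)) + cmod (b * u (n - 1)) + cmod ((u n)\<^sup>2)"
    unfolding forcing_def distrib_left
    by (meson add_right_mono norm_triangle_ineq norm_triangle_ineq4 order_trans)
  ultimately show ?thesis using b_le(2) zero_le_power2[of r] by linarith
qed

text \<open>Both uses of the contraction in one statement: for existence, \<open>v\<close> is the solution operator applied to the
forcing of \<open>u\<close>; for uniqueness, \<open>v\<close> is \<open>u\<close> itself.\<close>

lemma forcing_contracts:
  assumes \<xi>: "\<xi> \<in> full_orbits"
    and u: "\<And>n. cmod (u n) \<le> r" and u': "\<And>n. cmod (u' n) \<le> r"
    and d: "\<And>n. cmod (u n - u' n) \<le> d"
    and v: "\<And>n. cmod (v n) \<le> B" "\<And>n. 2 * \<xi> n * v n = v (n + 1) + forcing \<xi> u n"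
    and v': "\<And>n. cmod (v' n) \<le> B" "\<And>n. 2 * \<xi> n * v' n = v' (n + 1) + forcing \<xi> u' n"
  shows "cmod (v n - v' n) \<le> d / 2"
proof -
  define w where "w n = v n - v' n" for n
  have w_le: "cmod (w n) \<le> B + B" for n
    unfolding w_def using v(1) v'(1) norm_triangle_ineq4 by (meson add_mono order_trans)
  \<comment> \<open>Subtracting the two recursions leaves the same linear part, driven by the difference of the forcings.\<close>
  have rec: "2 * \<xi> n * w n = w (n + 1) + (forcing \<xi> u n - forcing \<xi> u' n)" for n
    using v(2)[of n] v'(2)[of n] by (simp add: w_def algebra_simps)
  have g: "cmod (forcing \<xi> u n - forcing \<xi> u' n) \<le> 4 * r * d" for n
  proof -
    have "forcing \<xi> u n - forcing \<xi> u' n = b * (u (n - 1) - u' (n - 1)) - (u n + u' n) * (u n - u' n)"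
      by (simp add: forcing_def power2_eq_square algebra_simps)
    moreover have "cmod (b * (u (n - 1) - u' (n - 1))) \<le> 2 * r * d"
      unfolding norm_mult by (intro mult_mono b_le d) (use r_pos in auto)
    moreover have "cmod (u n + u' n) \<le> 2 * r"
      using norm_triangle_ineq[of "u n" "u' n"] u[of n] u'[of n] by linarith
    then have "cmod ((u n + u' n) * (u n - u' n)) \<le> 2 * r * d"
      unfolding norm_mult by (intro mult_mono d) (use r_pos in auto)
    ultimately show ?thesis
      using norm_triangle_ineq4[of "b * (u (n - 1) - u' (n - 1))" "(u n + u' n) * (u n - u' n)"]
      by simp
  qed
  have "cmod (w n) \<le> (4 * r * d) / (C * (l - 1))"
    by (rule expanding_recursion_bound[OF C_pos l_gt_1 full_orbit_multipliers[OF \<xi>] w_le rec g])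
  also have "\<dots> = d / 2" using r_pos by (simp add: gap_eq)
  finally show ?thesis by (simp add: w_def)
qed

definition shadows :: "(int \<Rightarrow> complex) \<Rightarrow> (int \<Rightarrow> complex) \<Rightarrow> bool" where
  "shadows x \<xi> \<longleftrightarrow> (\<forall>n. cmod (x n - \<xi> n) \<le> r) \<and> (\<forall>n. x (n + 1) = quad c (x n) - b * x (n - 1))"

text \<open>The operator \<open>G\<close> inverts the linear part, so a fixed point of \<open>u \<mapsto> G (forcing \<xi> u)\<close> is a correction
that turns \<open>\<xi>\<close> into a solution of the Henon recursion.\<close>

lemma shadow_exists:
  assumes \<xi>: "\<xi> \<in> full_orbits"
  obtains x where "shadows x \<xi>"
proof -
  obtain G where G: "\<And>g M. (\<And>n. cmod (g n) \<le> M) \<Longrightarrow>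
       (\<forall>n. 2 * \<xi> n * G g n = G g (n + 1) + g n) \<and> (\<forall>n. cmod (G g n) \<le> M / (C * (l - 1)))"
    using expanding_recursion_solution[OF C_pos l_gt_1 full_orbit_multipliers[OF \<xi>]] by blast
  have 8: "8 * r\<^sup>2 / (C * (l - 1)) = r"
    using r_pos by (simp add: gap_eq power2_eq_square)
  have G_rec: "2 * \<xi> n * G (forcing \<xi> u) n = G (forcing \<xi> u) (n + 1) + forcing \<xi> u n"
    and G_le: "cmod (G (forcing \<xi> u) n) \<le> r" if "\<And>n. cmod (u n) \<le> r" for u n
    using G[of "forcing \<xi> u", OF forcing_bound[OF \<xi> that]] by (auto simp: 8)
  \<comment> \<open>The ball of radius r is mapped into itself since 8 * r^2 / (8 * r) = r.\<close>
  have "\<exists>u. (\<forall>n. norm (u n) \<le> r) \<and> G (forcing \<xi> u) = u"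
  proof (rule sup_contraction_fixed_point)
    show "0 \<le> r" using r_pos by simp
    show "norm (G (forcing \<xi> u) n) \<le> r" if "\<And>m. norm (u m) \<le> r" for u n
      by (rule G_le[OF that])
    show "norm (G (forcing \<xi> u) n - G (forcing \<xi> v) n) \<le> d / 2"
      if "\<And>m. norm (u m) \<le> r" "\<And>m. norm (v m) \<le> r" "\<And>m. norm (u m - v m) \<le> d" for u v d n
      by (rule forcing_contracts[OF \<xi> that G_le[OF that(1)] G_rec[OF that(1)] G_le[OF that(2)] G_rec[OF that(2)]])
  qed
  then obtain u where u: "\<And>n. cmod (u n) \<le> r" "G (forcing \<xi> u) = u" by blast
  have "shadows (\<lambda>n. \<xi> n + u n) \<xi>"
    unfolding shadows_def
  proof (intro conjI allI)
    fix n
    show "cmod (\<xi> n + u n - \<xi> n) \<le> r" using u(1) by simp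
    have "2 * \<xi> n * u n = u (n + 1) + forcing \<xi> u n"
      using G_rec[of u n, OF u(1)] by (simp add: u(2))
    then show "\<xi> (n + 1) + u (n + 1) = quad c (\<xi> n + u n) - b * (\<xi> (n - 1) + u (n - 1))"
      using full_orbitsD(2)[OF \<xi>, of n]
      by (simp add: quad_def forcing_def power2_eq_square algebra_simps)
  qed
  then show ?thesis using that by blast
qed

lemma shadow_unique:
  assumes \<xi>: "\<xi> \<in> full_orbits" and x: "shadows x \<xi>" and y: "shadows y \<xi>"
  shows "x = y"
proof -
  have le: "cmod (x n - \<xi> n) \<le> r" if "shadows x \<xi>" for x n
    using that by (simp add: shadows_def)
  have rec: "2 * \<xi> n * (x n - \<xi> n)
      = (x (n + 1) - \<xi> (n + 1)) + forcing \<xi> (\<lambda>n. x n - \<xi> n) n" if "shadows x \<xi>" for x n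
  proof -
    have "x (n + 1) = quad c (x n) - b * x (n - 1)"
      using that by (simp add: shadows_def)
    then show ?thesis
      unfolding full_orbitsD(2)[OF \<xi>] forcing_def
      by (simp add: quad_def power2_eq_square algebra_simps)
  qed
  have "(x n - \<xi> n) - (y n - \<xi> n) = 0" for n
  proof (rule zero_if_bound_halves[where v = "\<lambda>n. (x n - \<xi> n) - (y n - \<xi> n)" and B = "r + r"])
    show "norm ((x n - \<xi> n) - (y n - \<xi> n)) \<le> r + r" for n
      using norm_triangle_ineq4[of "x n - \<xi> n" "y n - \<xi> n"] le[OF x, of n] le[OF y, of n] by linarith
    show "norm ((x n - \<xi> n) - (y n - \<xi> n)) \<le> d / 2"
      if "\<And>m. norm ((x m - \<xi> m) - (y m - \<xi> m)) \<le> d" for d n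
      by (rule forcing_contracts[OF \<xi> le[OF x] le[OF y] that le[OF x] rec[OF x] le[OF y] rec[OF y]])
  qed
  then show ?thesis by auto
qed

text \<open>Two orbits shadowed by the same sequence are within \<open>2 * r\<close> of each other.\<close>

lemma shadowed_orbit_unique:
  assumes "\<xi> \<in> full_orbits" "\<xi>' \<in> full_orbits" "shadows x \<xi>" "shadows x \<xi>'"
  shows "\<xi>' = \<xi>"
proof (rule full_orbits_expansive)
  fix n
  have "cmod (x n - \<xi> n) \<le> r" "cmod (x n - \<xi>' n) \<le> r"
    using assms by (auto simp: shadows_def)
  moreover have eq: "\<xi>' n - \<xi> n = (x n - \<xi> n) - (x n - \<xi>' n)" by simp
  ultimately show "cmod (\<xi>' n - \<xi> n) \<le> 2 * r"
    unfolding eq using norm_triangle_ineq4[of "x n - \<xi> n" "x n - \<xi>' n"] by linarith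
qed (use assms in auto)

lemma shadow_away_from_0:
  assumes "\<xi> \<in> full_orbits" "shadows x \<xi>"
  shows "\<delta> \<le> cmod (2 * x n)"
proof -
  have "cmod (2 * \<xi> n) \<le> cmod (2 * x n) + cmod (2 * (\<xi> n - x n))"
    using norm_triangle_ineq[of "2 * x n" "2 * (\<xi> n - x n)"] by (simp add: algebra_simps)
  moreover have "cmod (2 * (\<xi> n - x n)) \<le> 2 * r"
    unfolding norm_mult using assms(2) by (simp add: shadows_def norm_minus_commute)
  ultimately show ?thesis
    using full_orbit_away_from_0[OF assms(1), of n] r_le_\<delta> \<delta>_pos by linarith
qed

section \<open>The compact space of orbits with their invariant directions\<close>

text \<open>A full orbit \<open>\<xi>\<close> of the quadratic map, the Henon orbit \<open>x\<close> that shadows it, and the slopes \<open>t\<close> and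
\<open>s\<close> of its stable and unstable directions.\<close>

type_synonym orbit_tuple =
  "(int \<Rightarrow> complex) \<times> (int \<Rightarrow> complex) \<times> (int \<Rightarrow> complex) \<times> (int \<Rightarrow> complex)"

text \<open>At the point \<open>(x n, x (n - 1))\<close> the derivative \<open>(h, k) \<mapsto> (2 x n h - b k, h)\<close> sends \<open>(t n, 1)\<close> to
\<open>(2 x n t n - b, t n)\<close>, which is a multiple of \<open>(t (n + 1), 1)\<close> exactly under the equation for \<open>t\<close>. It sends
\<open>(b, s n)\<close> to \<open>b (2 x n - s n, 1)\<close>, a multiple of \<open>(b, s (n + 1))\<close> exactly under the equation for \<open>s\<close>.
The equations are written without quotients so that they define a closed set.\<close>

definition orbit_data :: "orbit_tuple set" where
  "orbit_data = {(\<xi>, x, t, s). \<xi> \<in> full_orbits \<and> shadows x \<xi> \<and>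
      (\<forall>n. cmod (t n) \<le> \<delta> / 2) \<and> (\<forall>n. t n * (2 * x n - t (n + 1)) = b) \<and>
      (\<forall>n. cmod (s n) \<le> \<delta> / 2) \<and> (\<forall>n. s n * (2 * x (n - 1) - s (n - 1)) = b)}"

lemma orbit_dataD:
  assumes "(\<xi>, x, t, s) \<in> orbit_data"
  shows "\<xi> \<in> full_orbits" "shadows x \<xi>"
    "cmod (t n) \<le> \<delta> / 2" "t n * (2 * x n - t (n + 1)) = b"
    "cmod (s n) \<le> \<delta> / 2" "s n * (2 * x (n - 1) - s (n - 1)) = b"
    "x (n + 1) = quad c (x n) - b * x (n - 1)"
  using assms by (auto simp: orbit_data_def shadows_def)

lemma orbit_data_exists:
  assumes \<xi>: "\<xi> \<in> full_orbits"
  obtains x t s where "(\<xi>, x, t, s) \<in> orbit_data"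
proof -
  obtain x where x: "shadows x \<xi>" using shadow_exists[OF \<xi>] .
  obtain t where t: "\<And>n. cmod (t n) \<le> \<delta> / 2" "\<And>n. t n * (2 * x n - t (n + 1)) = b"
    using continued_fraction_exists[of \<delta> "\<lambda>n. 2 * x n" b "\<lambda>n. n + 1"]
      \<delta>_pos shadow_away_from_0[OF \<xi> x] b_le_\<delta>_squared by metis
  obtain s where s: "\<And>n. cmod (s n) \<le> \<delta> / 2" "\<And>n. s n * (2 * x (n - 1) - s (n - 1)) = b"
    using continued_fraction_exists[of \<delta> "\<lambda>n. 2 * x (n - 1)" b "\<lambda>n. n - 1"]
      \<delta>_pos shadow_away_from_0[OF \<xi> x] b_le_\<delta>_squared by metis
  show ?thesis
    using that[of x t s] \<xi> x t s by (simp add: orbit_data_def)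
qed

lemma slopes_unique:
  assumes "(\<xi>, x, t, s) \<in> orbit_data" "(\<xi>, x, t', s') \<in> orbit_data"
  shows "t = t'" "s = s'"
proof -
  note D = orbit_dataD[OF assms(1)] and D' = orbit_dataD[OF assms(2)]
  note a = shadow_away_from_0[OF D(1,2)]
  show "t = t'"
    by (rule continued_fraction_unique[of \<delta> "\<lambda>n. 2 * x n" b t "\<lambda>n. n + 1"])
      (rule \<delta>_pos a b_le_\<delta>_squared D D')+
  show "s = s'"
    by (rule continued_fraction_unique[of \<delta> "\<lambda>n. 2 * x (n - 1)" b s "\<lambda>n. n - 1"])
      (rule \<delta>_pos a b_le_\<delta>_squared D D')+
qed

text \<open>Everything is determined by the unperturbed orbit, and also by the perturbed one.\<close>

lemma orbit_data_eqI:
  assumes "(\<xi>, x, t, s) \<in> orbit_data" "(\<xi>', x', t', s') \<in> orbit_data"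
    and "\<xi> = \<xi>' \<or> x = x'"
  shows "(\<xi>, x, t, s) = (\<xi>', x', t', s')"
proof -
  have "\<xi> = \<xi>' \<and> x = x'"
    using assms shadow_unique shadowed_orbit_unique by (metis orbit_dataD(1,2))
  with slopes_unique assms show ?thesis by blast
qed

definition shift_data where
  "shift_data k = (\<lambda>(\<xi>, x, t, s). (\<lambda>n::int. \<xi> (n + k) :: complex, \<lambda>n::int. x (n + k) :: complex,
                      \<lambda>n::int. t (n + k) :: complex, \<lambda>n::int. s (n + k) :: complex))"

lemma shift_data_mem:
  assumes "P \<in> orbit_data"
  shows "shift_data k P \<in> orbit_data"
proof -
  obtain \<xi> x t s where P: "P = (\<xi>, x, t, s)" by (cases P)
  note D = orbit_dataD[OF assms[unfolded P]]
  have "shadows (\<lambda>n. x (n + k)) (\<lambda>n. \<xi> (n + k))"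
    unfolding shadows_def
  proof (intro conjI allI)
    fix n
    show "cmod (x (n + k) - \<xi> (n + k)) \<le> r" using D(2) by (simp add: shadows_def)
    show "x (n + 1 + k) = quad c (x (n + k)) - b * x (n - 1 + k)"
      using D(7)[of "n + k"] by (simp add: algebra_simps)
  qed
  moreover have "(\<lambda>n. \<xi> (n + k)) \<in> full_orbits"
    using D(1) full_orbitsD(2)[OF D(1)] unfolding full_orbits_def
    by (auto simp: algebra_simps) (metis add.assoc add.commute)
  moreover have "t (n + k) * (2 * x (n + k) - t (n + 1 + k)) = b" for n
    using D(4)[of "n + k"] by (simp add: algebra_simps)
  moreover have "s (n + k) * (2 * x (n - 1 + k) - s (n - 1 + k)) = b" for n
    using D(6)[of "n + k"] by (simp add: algebra_simps)
  ultimately show ?thesis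
    using D(3,5) by (auto simp: orbit_data_def shift_data_def P)
qed

lemma shift_data_add: "shift_data j (shift_data k P) = shift_data (j + k) P"
  by (cases P) (simp add: shift_data_def algebra_simps)

lemma shift_data_0: "shift_data 0 P = P"
  by (cases P) (simp add: shift_data_def)

text \<open>All coordinates range over compact sets, and each of the remaining conditions is an equation
or weak inequality between finitely many coordinates.\<close>

lemma compact_orbit_data: "compact orbit_data"
proof -
  let ?B = "\<lambda>\<rho>. {f :: int \<Rightarrow> complex. \<forall>n. f n \<in> cball 0 \<rho>}"
  let ?K = "{f :: int \<Rightarrow> complex. \<forall>n. f n \<in> \<Lambda>} \<times> ?B (R + r) \<times> ?B (\<delta> / 2) \<times> ?B (\<delta> / 2)"
  have K: "compact ?K"
    by (intro compact_Times compact_sequences compact_base compact_cball)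
  \<comment> \<open>The defining conditions, with membership in balls and in the base set split off into the compact box.\<close>
  let ?E = "{P. (\<forall>n. fst P (n + 1) = quad c (fst P n)) \<and> (\<forall>n. cmod (fst (snd P) n - fst P n) \<le> r) \<and>
      (\<forall>n. fst (snd P) (n + 1) = quad c (fst (snd P) n) - b * fst (snd P) (n - 1)) \<and>
      (\<forall>n. fst (snd (snd P)) n * (2 * fst (snd P) n - fst (snd (snd P)) (n + 1)) = b) \<and>
      (\<forall>n. snd (snd (snd P)) n * (2 * fst (snd P) (n - 1) - snd (snd (snd P)) (n - 1)) = b)}
      :: orbit_tuple set"
  have coord: "continuous_on UNIV (\<lambda>P. f P n)" if "continuous_on UNIV f"
    for f :: "orbit_tuple \<Rightarrow> int \<Rightarrow> complex" and n
    using that by (rule continuous_on_product_then_coordinatewise)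
  have E: "closed ?E"
    unfolding quad_def
    by (intro closed_Collect_conj closed_Collect_all closed_Collect_eq closed_Collect_le
        continuous_intros coord)
  have "orbit_data = ?K \<inter> ?E"
  proof (intro set_eqI iffI)
    fix P assume "P \<in> orbit_data"
    moreover obtain \<xi> x t s where P: "P = (\<xi>, x, t, s)" by (cases P)
    ultimately have P': "(\<xi>, x, t, s) \<in> orbit_data" by simp
    note D = orbit_dataD[OF P']
    have "cmod (x n) \<le> R + r" for n
    proof -
      have "cmod (x n - \<xi> n) \<le> r" using D(2) by (simp add: shadows_def)
      then show ?thesis
        using full_orbitsD(3)[OF D(1), of n] norm_triangle_ineq2[of "x n" "\<xi> n"] by linarith
    qed
    then show "P \<in> ?K \<inter> ?E"
      using D(2-7) full_orbitsD[OF D(1)] by (auto simp: P shadows_def)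
  next
    fix P assume "P \<in> ?K \<inter> ?E"
    then show "P \<in> orbit_data"
      by (cases P) (auto simp: orbit_data_def full_orbits_def shadows_def)
  qed
  then show ?thesis using compact_Int_closed[OF K E] by simp
qed

text \<open>The point of the inverse limit over the graph \<open>{(quad c x, x) | x. x \<in> \<Lambda>}\<close> that the nonpositive part
of \<open>\<xi>\<close> encodes.\<close>

definition history :: "orbit_tuple \<Rightarrow> nat \<Rightarrow> complex \<times> complex" where
  "history P k = (fst P (1 - int k), fst P (- int k))"

definition base_point :: "orbit_tuple \<Rightarrow> complex \<times> complex" where
  "base_point P = (fst (snd P) 1, fst (snd P) 0)"

lemma history_shift:
  assumes "P \<in> orbit_data"
  shows "history (shift_data 1 P) = shift_map (henon c 0) (history P)"
proof
  fix k
  obtain \<xi> x t s where P: "P = (\<xi>, x, t, s)" by (cases P)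
  have "\<xi> 2 = quad c (\<xi> 1)"
    using full_orbitsD(2)[OF orbit_dataD(1)[OF assms[unfolded P]], of 1] by simp
  then show "history (shift_data 1 P) k = shift_map (henon c 0) (history P) k"
    by (cases k) (simp_all add: P history_def shift_data_def shift_map_def henon_def quad_def)
qed

lemma base_point_shift:
  assumes "P \<in> orbit_data"
  shows "base_point (shift_data 1 P) = henon c b (base_point P)"
proof -
  obtain \<xi> x t s where P: "P = (\<xi>, x, t, s)" by (cases P)
  show ?thesis
    using orbit_dataD(7)[OF assms[unfolded P], of 1]
    by (simp add: P base_point_def shift_data_def henon_def quad_def)
qed

text \<open>The past of a full orbit determines its future, and the full orbit determines the rest.\<close>

lemma inj_history: "inj_on history orbit_data"
proof (rule inj_onI)
  fix P P' assume PP: "P \<in> orbit_data" "P' \<in> orbit_data" and eq: "history P = history P'"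
  obtain \<xi> x t s where P: "P = (\<xi>, x, t, s)" by (cases P)
  obtain \<xi>' x' t' s' where P': "P' = (\<xi>', x', t', s')" by (cases P')
  note D = orbit_dataD(1)[OF PP(1)[unfolded P]] orbit_dataD(1)[OF PP(2)[unfolded P']]
  have neg: "\<xi> (- int k) = \<xi>' (- int k)" for k
    using fun_cong[OF eq, of k] by (simp add: P P' history_def)
  have "\<xi> n = \<xi>' n" for n
  proof (cases "n \<le> 0")
    case True
    then show ?thesis using neg[of "nat (- n)"] by simp
  next
    case False
    then show ?thesis
      using neg[of 0] full_orbit_iterate[OF D(1), of 0 "nat n"] full_orbit_iterate[OF D(2), of 0 "nat n"]
      by simp
  qed
  then have "\<xi> = \<xi>'" by auto
  then show "P = P'" using orbit_data_eqI PP unfolding P P' by blast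
qed

text \<open>Two neighbouring terms determine a solution of the recursion: forwards by definition, backwards
because \<open>b \<noteq> 0\<close>.\<close>

lemma inj_base_point: "inj_on base_point orbit_data"
proof (rule inj_onI)
  fix P P' assume PP: "P \<in> orbit_data" "P' \<in> orbit_data" and eq: "base_point P = base_point P'"
  obtain \<xi> x t s where P: "P = (\<xi>, x, t, s)" by (cases P)
  obtain \<xi>' x' t' s' where P': "P' = (\<xi>', x', t', s')" by (cases P')
  note rec = orbit_dataD(7)[OF PP(1)[unfolded P]] orbit_dataD(7)[OF PP(2)[unfolded P']]
  have pair: "x n = x' n \<and> x (n + 1) = x' (n + 1)" for n
  proof (induction n rule: int_induct[where k = 0])
    case base
    show ?case using eq by (simp add: P P' base_point_def)
  next
    case (step1 i)
    then show ?case using rec[of "i + 1"] by simp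
  next
    case (step2 i)
    then have "quad c (x i) - b * x (i - 1) = quad c (x i) - b * x' (i - 1)"
      using rec[of i] by metis
    then show ?case using step2 b_nz by simp
  qed
  then have "x = x'" by auto
  then show "P = P'" using orbit_data_eqI PP unfolding P P' by blast
qed

text \<open>A point of the inverse limit is a past; iterating the quadratic map extends it to a full orbit, which
stays in \<open>\<Lambda>\<close> by forward invariance.\<close>

lemma history_image:
  "history ` orbit_data = proj_lim {(quad c x, x) | x. x \<in> \<Lambda>} (henon c 0)"
proof (intro equalityI subsetI)
  fix w assume "w \<in> history ` orbit_data"
  then obtain \<xi> x t s where P: "(\<xi>, x, t, s) \<in> orbit_data" "w = history (\<xi>, x, t, s)" by auto
  note \<xi> = full_orbitsD[OF orbit_dataD(1)[OF P(1)]]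
  have w_eq: "w k = (quad c (\<xi> (- int k)), \<xi> (- int k))" for k
    using \<xi>(2)[of "- int k"] by (simp add: P(2) history_def)
  have step: "quad c (\<xi> (- int (Suc k))) = \<xi> (- int k)" for k
    using \<xi>(2)[of "- int (Suc k)"] by simp
  have "henon c 0 (w (Suc k)) = w k" for k
    unfolding w_eq henon_def using step[of k] by (simp add: quad_def)
  moreover have "w k \<in> {(quad c x, x) | x. x \<in> \<Lambda>}" for k
    unfolding w_eq using \<xi>(1) by blast
  ultimately show "w \<in> proj_lim {(quad c x, x) | x. x \<in> \<Lambda>} (henon c 0)"
    by (simp add: proj_lim_def)
next
  fix w assume w: "w \<in> proj_lim {(quad c x, x) | x. x \<in> \<Lambda>} (henon c 0)"
  define z where "z k = snd (w k)" for k
  have z_mem: "z k \<in> \<Lambda>" and w_eq: "w k = (quad c (z k), z k)" for k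
  proof -
    have "w k \<in> {(quad c x, x) | x. x \<in> \<Lambda>}" using w by (simp add: proj_lim_def)
    then show "z k \<in> \<Lambda>" "w k = (quad c (z k), z k)" by (auto simp: z_def)
  qed
  have z_step: "quad c (z (Suc k)) = z k" for k
  proof -
    have "henon c 0 (w (Suc k)) = w k" using w by (simp add: proj_lim_def)
    then show ?thesis by (simp add: w_eq henon_def)
  qed
  define \<xi> where "\<xi> n = (if n \<le> 0 then z (nat (- n)) else (quad c ^^ nat n) (z 0))" for n
  have iter_mem: "(quad c ^^ j) (z 0) \<in> \<Lambda>" for j
    by (induction j) (use z_mem forward_invariant in auto)
  have \<xi>: "\<xi> \<in> full_orbits"
    unfolding full_orbits_def
  proof (intro CollectI allI conjI)
    fix n
    show "\<xi> n \<in> \<Lambda>" using z_mem iter_mem by (simp add: \<xi>_def)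
    consider "n < 0" | "n = 0" | "n > 0" by linarith
    then show "\<xi> (n + 1) = quad c (\<xi> n)"
    proof cases
      case 1
      then have "nat (- n) = Suc (nat (- (n + 1)))" by simp
      then show ?thesis using 1 z_step[of "nat (- (n + 1))"] by (simp add: \<xi>_def)
    next
      case 2
      then show ?thesis by (simp add: \<xi>_def)
    next
      case 3
      then have "nat (n + 1) = Suc (nat n)" by simp
      then show ?thesis using 3 by (simp add: \<xi>_def)
    qed
  qed
  obtain x t s where P: "(\<xi>, x, t, s) \<in> orbit_data" using orbit_data_exists[OF \<xi>] .
  have "history (\<xi>, x, t, s) k = w k" for k
    using full_orbitsD(2)[OF \<xi>, of "- int k"] by (simp add: history_def w_eq \<xi>_def)
  then have "w = history (\<xi>, x, t, s)" by auto
  then show "w \<in> history ` orbit_data" using P by (rule image_eqI)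
qed

lemma continuous_history: "continuous_on S history"
proof (rule continuous_on_coordinatewise_then_product)
  fix k
  have *: "continuous_on S (\<lambda>P. fst P n)"
    for n :: int and S :: "orbit_tuple set"
    by (rule continuous_on_product_then_coordinatewise[OF continuous_on_fst[OF continuous_on_id]])
  show "continuous_on S (\<lambda>P. history P k)"
    unfolding history_def by (rule continuous_on_Pair[OF * *])
qed

lemma continuous_base_point: "continuous_on S base_point"
proof -
  have *: "continuous_on S (\<lambda>P. fst (snd P) n)"
    for n :: int and S :: "orbit_tuple set"
    by (rule continuous_on_product_then_coordinatewise[OF continuous_on_fst[OF continuous_on_snd[OF continuous_on_id]]])
  have "continuous_on S (\<lambda>P. (fst (snd P) 1, fst (snd P) 0))"
    by (rule continuous_on_Pair[OF * *])
  then show ?thesis by (simp add: base_point_def[abs_def])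
qed

section \<open>Hyperbolicity\<close>

lemma stable_slope_bound:
  assumes "(\<xi>, x, t, s) \<in> orbit_data"
  shows "cmod (t n) * (\<delta> / 2) \<le> cmod b"
proof -
  note D = orbit_dataD[OF assms]
  have "\<delta> / 2 \<le> cmod (2 * x n - t (n + 1))"
    using norm_triangle_ineq2[of "2 * x n" "t (n + 1)"] shadow_away_from_0[OF D(1,2), of n] D(3)[of "n + 1"]
    by linarith
  then have "cmod (t n) * (\<delta> / 2) \<le> cmod (t n) * cmod (2 * x n - t (n + 1))"
    by (rule mult_left_mono) simp
  also have "\<dots> = cmod b" using D(4)[of n] by (metis norm_mult)
  finally show ?thesis .
qed

lemma unstable_slope_bound:
  assumes "(\<xi>, x, t, s) \<in> orbit_data"
  shows "cmod (s n) * (\<delta> / 2) \<le> cmod b"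
proof -
  note D = orbit_dataD[OF assms]
  have "\<delta> / 2 \<le> cmod (2 * x (n - 1) - s (n - 1))"
    using norm_triangle_ineq2[of "2 * x (n - 1)" "s (n - 1)"] shadow_away_from_0[OF D(1,2), of "n - 1"]
      D(5)[of "n - 1"] by linarith
  then have "cmod (s n) * (\<delta> / 2) \<le> cmod (s n) * cmod (2 * x (n - 1) - s (n - 1))"
    by (rule mult_left_mono) simp
  also have "\<dots> = cmod b" using D(6)[of n] by (metis norm_mult)
  finally show ?thesis .
qed

lemma stable_slope_le_half:
  assumes "(\<xi>, x, t, s) \<in> orbit_data"
  shows "cmod (t n) \<le> 1 / 2"
proof -
  have "cmod (t n) * (\<delta> / 2) \<le> 1 / 2 * (\<delta> / 2)"
    using stable_slope_bound[OF assms, of n] b_le(4) by linarith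
  then show ?thesis using \<delta>_pos by (simp add: mult_le_cancel_right)
qed

lemma unstable_slope_le_radius:
  assumes "(\<xi>, x, t, s) \<in> orbit_data"
  shows "cmod (s n) \<le> r"
proof -
  have "cmod (s n) * (\<delta> / 2) \<le> r * (\<delta> / 2)"
    using unstable_slope_bound[OF assms, of n] b_le(3) by linarith
  then show ?thesis using \<delta>_pos by (simp add: mult_le_cancel_right)
qed

text \<open>This is the nonvanishing of the determinant of \<open>(t n, 1)\<close> and \<open>(b, s n)\<close>.\<close>

lemma slopes_transversal:
  assumes "(\<xi>, x, t, s) \<in> orbit_data"
  shows "t n * s n \<noteq> b"
proof
  assume "t n * s n = b"
  then have "cmod b = cmod (t n) * cmod (s n)" by (metis norm_mult)
  also have "\<dots> \<le> cmod (t n) * (\<delta> / 4)"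
    using unstable_slope_le_radius[OF assms, of n] r_le_\<delta> by (intro mult_left_mono) auto
  also have "\<dots> \<le> cmod b / 2" using stable_slope_bound[OF assms, of n] by linarith
  finally show False using b_nz by simp
qed

text \<open>The index is 1 because the point belonging to a tuple is \<open>(x 1, x 0)\<close>.\<close>

definition stable_dir where "stable_dir P = (fst (snd (snd P)) (1::int) :: complex, 1 :: complex)"

definition unstable_dir where "unstable_dir P = (b, snd (snd (snd P)) (1::int) :: complex)"

lemma henon_deriv_stable_dir:
  assumes "P \<in> orbit_data"
  shows "henon_deriv b (base_point P) (cscale h (stable_dir P))
    = cscale (h * fst (stable_dir P)) (stable_dir (shift_data 1 P))"
proof -
  obtain \<xi> x t s where P: "P = (\<xi>, x, t, s)" by (cases P)
  have "2 * x 1 * t 1 - b = t 1 * t 2"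
    using orbit_dataD(4)[OF assms[unfolded P], of 1] by (simp add: algebra_simps)
  then have "h * (2 * x 1 * t 1 - b) = h * (t 1 * t 2)" by simp
  then show ?thesis
    by (simp add: P henon_deriv_def base_point_def stable_dir_def shift_data_def cscale_def algebra_simps)
qed

text \<open>The factor by which the derivative stretches the unstable direction, measured by the vectors
\<open>(b, s n)\<close>; it is a small perturbation of \<open>2 * \<xi> n\<close>.\<close>

definition unstable_multiplier where
  "unstable_multiplier P n = 2 * fst (snd P) (n::int) - (snd (snd (snd P)) n :: complex)"

lemma henon_deriv_unstable_dir:
  assumes "P \<in> orbit_data"
  shows "henon_deriv b (base_point P) (cscale h (unstable_dir P))
    = cscale (h * unstable_multiplier P 1) (unstable_dir (shift_data 1 P))"
proof -
  obtain \<xi> x t s where P: "P = (\<xi>, x, t, s)" by (cases P)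
  have "b = s 2 * (2 * x 1 - s 1)"
    using orbit_dataD(6)[OF assms[unfolded P], of 2] by simp
  then have "h * b = h * (s 2 * (2 * x 1 - s 1))" by simp
  then show ?thesis
    by (simp add: P henon_deriv_def base_point_def unstable_dir_def shift_data_def cscale_def
        unstable_multiplier_def algebra_simps)
qed

lemma henon_inv_deriv_unstable_dir:
  assumes P: "P \<in> orbit_data"
  shows "henon_inv_deriv b (base_point P) (cscale h (unstable_dir P))
    = cscale (h / unstable_multiplier P 0) (unstable_dir (shift_data (- 1) P))"
proof -
  obtain \<xi> x t s where P': "P = (\<xi>, x, t, s)" by (cases P)
  note D = orbit_dataD[OF P[unfolded P']]
  have e: "s 1 * (2 * x 0 - s 0) = b" using D(6)[of 1] by simp
  then have nz: "2 * x 0 - s 0 \<noteq> 0" using b_nz by auto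
  then have s1: "s 1 = b / (2 * x 0 - s 0)" using e by (simp add: eq_divide_eq)
  have "2 * x 0 * s 1 - b = b * s 0 / (2 * x 0 - s 0)"
    using nz by (simp add: s1 divide_simps) (simp add: algebra_simps)
  then have "2 * x 0 * (h * s 1) - h * b = h * (b * s 0 / (2 * x 0 - s 0))"
    by (metis mult.left_commute right_diff_distrib)
  then have snd_eq: "(2 * x 0 * (h * s 1) - h * b) / b = h / (2 * x 0 - s 0) * s 0"
    unfolding \<open>2 * x 0 * (h * s 1) - h * b = _\<close> using b_nz by simp
  have fst_eq: "h * s 1 = h / (2 * x 0 - s 0) * b" by (simp add: s1)
  show ?thesis
    using fst_eq snd_eq
    by (simp add: P' henon_inv_deriv_def base_point_def unstable_dir_def shift_data_def cscale_def
        unstable_multiplier_def)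
qed

lemma base_point_shift_back:
  assumes "P \<in> orbit_data"
  shows "base_point (shift_data (- 1) P) = henon_inv c b (base_point P)"
  using base_point_shift[OF shift_data_mem[OF assms], of "- 1"]
  by (simp add: shift_data_add shift_data_0 henon_inv_henon[OF b_nz])

lemma stable_contraction:
  assumes "P \<in> orbit_data"
  shows "max_norm (iterate_derivative (henon c b) (henon_deriv b) n (base_point P) (cscale h (stable_dir P)))
    \<le> (1 / 2) ^ n * max_norm (cscale h (stable_dir P))"
  using assms
proof (induction n arbitrary: P h)
  case 0
  show ?case by simp
next
  case (Suc n)
  have t: "cmod (fst (stable_dir P)) \<le> 1 / 2" if "P \<in> orbit_data" for P
    using that stable_slope_le_half by (cases P) (auto simp: stable_dir_def)
  then have one: "max_norm (stable_dir P) = 1" if "P \<in> orbit_data" for P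
    using t[OF that] by (simp add: max_norm_def stable_dir_def)
  let ?h = "h * fst (stable_dir P)" and ?P = "shift_data 1 P"
  have P: "?P \<in> orbit_data" by (rule shift_data_mem[OF Suc.prems])
  have "max_norm (iterate_derivative (henon c b) (henon_deriv b) (Suc n) (base_point P) (cscale h (stable_dir P)))
      = max_norm (iterate_derivative (henon c b) (henon_deriv b) n (base_point ?P) (cscale ?h (stable_dir ?P)))"
    by (simp add: henon_deriv_stable_dir base_point_shift Suc.prems)
  also have "\<dots> \<le> (1 / 2) ^ n * max_norm (cscale ?h (stable_dir ?P))"
    by (rule Suc.IH[OF P])
  also have "\<dots> = (1 / 2) ^ n * (cmod h * cmod (fst (stable_dir P)))"
    by (simp add: max_norm_cscale one[OF P] norm_mult)
  also have "\<dots> \<le> (1 / 2) ^ n * (cmod h * (1 / 2))"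
    by (intro mult_left_mono t Suc.prems) auto
  also have "\<dots> = (1 / 2) ^ Suc n * max_norm (cscale h (stable_dir P))"
    by (simp add: max_norm_cscale one[OF Suc.prems])
  finally show ?case .
qed

text \<open>A lower bound for the ratio of a perturbed multiplier to \<open>2 * \<xi> n\<close>: the two differ by at most \<open>3 * r\<close>, while
\<open>2 * \<xi> n\<close> has modulus at least \<open>2 * \<delta>\<close>.\<close>

definition \<theta> :: real where "\<theta> = 1 - 3 * r / (2 * \<delta>)"

lemma \<theta>_pos: "0 < \<theta>" and expansion_rate: "1 < l * \<theta>"
proof -
  have "3 * r \<le> \<delta>" using r_le_\<delta> r_pos by linarith
  then show "0 < \<theta>" using \<delta>_pos by (simp add: \<theta>_def)
  have "l * \<theta> = (5 * l + 3) / 8"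
    using C_pos l_gt_1 by (simp add: \<theta>_def r_def \<delta>_def field_simps)
  then show "1 < l * \<theta>" using l_gt_1 by simp
qed

lemma unstable_multiplier_ge:
  assumes "(\<xi>, x, t, s) \<in> orbit_data"
  shows "\<theta> * cmod (2 * \<xi> n) \<le> cmod (unstable_multiplier (\<xi>, x, t, s) n)"
proof -
  note D = orbit_dataD[OF assms]
  have "cmod (2 * (\<xi> n - x n)) \<le> 2 * r"
    unfolding norm_mult using D(2) by (simp add: shadows_def norm_minus_commute)
  moreover have "2 * \<xi> n = (2 * x n - s n) + (2 * (\<xi> n - x n) + s n)" by simp
  then have "cmod (2 * \<xi> n) \<le> cmod (2 * x n - s n) + (cmod (2 * (\<xi> n - x n)) + cmod (s n))"
    by (metis add_left_mono norm_triangle_ineq order_trans)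
  ultimately have "cmod (2 * \<xi> n) - 3 * r \<le> cmod (2 * x n - s n)"
    using unstable_slope_le_radius[OF assms, of n] by linarith
  moreover have "3 * r / (2 * \<delta>) * (2 * \<delta>) \<le> 3 * r / (2 * \<delta>) * cmod (2 * \<xi> n)"
    by (rule mult_left_mono[OF full_orbit_away_from_0[OF D(1)]]) (use r_pos \<delta>_pos in simp)
  then have "3 * r \<le> 3 * r / (2 * \<delta>) * cmod (2 * \<xi> n)" using \<delta>_pos by simp
  ultimately show ?thesis
    by (simp add: \<theta>_def unstable_multiplier_def algebra_simps)
qed

text \<open>Comparing factor by factor transfers the expansion of the unperturbed orbit, whose constant \<open>C\<close> is kept
and whose rate drops from \<open>l\<close> to \<open>l * \<theta> > 1\<close>.\<close>

lemma unstable_multipliers_expand: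
  assumes P: "P \<in> orbit_data" and n: "n \<ge> 1"
  shows "C * (l * \<theta>) ^ n \<le> cmod (\<Prod>j<n. unstable_multiplier P (- int j))"
proof -
  obtain \<xi> x t s where P': "P = (\<xi>, x, t, s)" by (cases P)
  note D = orbit_dataD[OF P[unfolded P']]
  \<comment> \<open>The product runs backwards in time; the expansion hypothesis is about the same block read forwards.\<close>
  have "(\<Prod>j<n. 2 * \<xi> (- int j)) = (\<Prod>j<n. 2 * \<xi> (1 - int n + int j))"
    by (subst prod.nat_diff_reindex[symmetric]) (auto intro!: prod.cong arg_cong[of _ _ \<xi>])
  then have "C * l ^ n \<le> cmod (\<Prod>j<n. 2 * \<xi> (- int j))"
    using full_orbit_multipliers[OF D(1)] n by (simp add: expanding_multipliers_def)
  then have "C * (l * \<theta>) ^ n \<le> \<theta> ^ n * cmod (\<Prod>j<n. 2 * \<xi> (- int j))"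
    using \<theta>_pos by (simp add: power_mult_distrib)
  also have "\<dots> = (\<Prod>j<n. \<theta> * cmod (2 * \<xi> (- int j)))"
    by (simp only: prod.distrib prod_norm prod_constant card_lessThan)
  also have "\<dots> \<le> (\<Prod>j<n. cmod (unstable_multiplier P (- int j)))"
    unfolding P' by (intro prod_mono conjI unstable_multiplier_ge[OF P[unfolded P']])
      (use \<theta>_pos in simp)
  finally show ?thesis by (simp only: prod_norm)
qed

lemma henon_inv_iterates_unstable_dir:
  assumes "P \<in> orbit_data"
  shows "iterate_derivative (henon_inv c b) (henon_inv_deriv b) n (base_point P) (cscale h (unstable_dir P))
    = cscale (h / (\<Prod>j<n. unstable_multiplier P (- int j))) (unstable_dir (shift_data (- int n) P))"
  using assms
proof (induction n arbitrary: P h)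
  case 0
  show ?case by (simp add: shift_data_0)
next
  case (Suc n)
  let ?P = "shift_data (- 1) P"
  have P: "?P \<in> orbit_data" by (rule shift_data_mem[OF Suc.prems])
  have "unstable_multiplier ?P m = unstable_multiplier P (m + - 1)" for m
    by (cases P) (simp add: unstable_multiplier_def shift_data_def)
  moreover have "- int j + - 1 = - int (Suc j)" for j by simp
  ultimately have mult: "unstable_multiplier ?P (- int j) = unstable_multiplier P (- int (Suc j))" for j
    by metis
  have "iterate_derivative (henon_inv c b) (henon_inv_deriv b) (Suc n) (base_point P) (cscale h (unstable_dir P))
      = iterate_derivative (henon_inv c b) (henon_inv_deriv b) n (base_point ?P)
          (cscale (h / unstable_multiplier P 0) (unstable_dir ?P))"
    by (simp add: henon_inv_deriv_unstable_dir base_point_shift_back Suc.prems)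
  also have "\<dots> = cscale (h / unstable_multiplier P 0 / (\<Prod>j<n. unstable_multiplier ?P (- int j)))
      (unstable_dir (shift_data (- int n) ?P))"
    by (rule Suc.IH[OF P])
  also have "\<dots> = cscale (h / (\<Prod>j<Suc n. unstable_multiplier P (- int j)))
      (unstable_dir (shift_data (- int (Suc n)) P))"
    unfolding prod.lessThan_Suc_shift mult shift_data_add by (simp add: algebra_simps)
  finally show ?case .
qed

text \<open>The frame \<open>(b, s n)\<close> is not normalised: its length lies between \<open>cmod b\<close> and \<open>\<delta>\<close>, which accounts for the
constant in front of the rate.\<close>

lemma unstable_expansion:
  assumes P: "P \<in> orbit_data" and n: "n \<ge> 1"
  shows "max_norm (iterate_derivative (henon_inv c b) (henon_inv_deriv b) n (base_point P) (cscale h (unstable_dir P)))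
    \<le> \<delta> / (C * cmod b) / (l * \<theta>) ^ n * max_norm (cscale h (unstable_dir P))"
proof -
  let ?M = "\<Prod>j<n. unstable_multiplier P (- int j)"
  have upper: "max_norm (unstable_dir Q) \<le> \<delta>" if "Q \<in> orbit_data" for Q
    using that orbit_dataD(5) b_le(4) \<delta>_pos
    by (cases Q) (auto simp: max_norm_def unstable_dir_def intro: order_trans[of _ "\<delta> / 2"])
  have pos: "0 < C * (l * \<theta>) ^ n" using C_pos expansion_rate by simp
  have "max_norm (cscale (h / ?M) (unstable_dir (shift_data (- int n) P)))
      \<le> cmod h / (C * (l * \<theta>) ^ n) * \<delta>"
    unfolding max_norm_cscale norm_divide
    by (intro mult_mono frac_le upper shift_data_mem P unstable_multipliers_expand n)
      (use pos in \<open>auto simp: max_norm_nonneg\<close>)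
  also have "\<dots> = \<delta> / (C * cmod b) / (l * \<theta>) ^ n * (cmod h * cmod b)"
    using b_nz by simp
  also have "\<dots> \<le> \<delta> / (C * cmod b) / (l * \<theta>) ^ n * max_norm (cscale h (unstable_dir P))"
    unfolding max_norm_cscale
    by (intro mult_left_mono) (use C_pos \<delta>_pos expansion_rate in \<open>auto simp: max_norm_def unstable_dir_def\<close>)
  finally show ?thesis by (simp only: henon_inv_iterates_unstable_dir[OF P])
qed

text \<open>The directions at a point are those of the orbit tuple over it. They depend continuously on the point
because the inverse of \<open>base_point\<close> is continuous.\<close>

lemma hyperbolic_base_points:
  assumes hom: "homeomorphism orbit_data (base_point ` orbit_data) base_point \<pi>'"
  shows "hyperbolic (henon c b) (base_point ` orbit_data)"
proof -
  let ?A = "base_point ` orbit_data"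
  have \<pi>'_base: "\<pi>' (base_point P) = P" if "P \<in> orbit_data" for P
    using hom that by (simp add: homeomorphism_def)
  have \<pi>'_cont: "continuous_on ?A \<pi>'" using hom by (simp add: homeomorphism_def)
  have inv: "invariant_set (henon c b) ?A"
    unfolding invariant_set_def
  proof (intro equalityI subsetI)
    fix z assume "z \<in> henon c b -` ?A"
    then obtain P where P: "P \<in> orbit_data" "henon c b z = base_point P" by auto
    have "z = base_point (shift_data (- 1) P)"
      using P henon_inv_henon[OF b_nz, of c z] by (simp add: base_point_shift_back)
    then show "z \<in> ?A" using shift_data_mem[OF P(1)] by blast
  next
    fix z assume "z \<in> ?A"
    then obtain P where P: "P \<in> orbit_data" "z = base_point P" by auto
    then have "henon c b z = base_point (shift_data 1 P)" by (simp add: base_point_shift)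
    then show "z \<in> henon c b -` ?A" using shift_data_mem[OF P(1)] by simp
  qed
  define Es where "Es z = range (\<lambda>h. cscale h (stable_dir (\<pi>' z)))" for z
  define Eu where "Eu z = range (\<lambda>h. cscale h (unstable_dir (\<pi>' z)))" for z
  have E_base: "Es (base_point P) = range (\<lambda>h. cscale h (stable_dir P))"
    "Eu (base_point P) = range (\<lambda>h. cscale h (unstable_dir P))" if "P \<in> orbit_data" for P
    by (simp_all add: Es_def Eu_def \<pi>'_base[OF that])
  have split: "splitting_at (Es z) (Eu z)" if z: "z \<in> ?A" for z
  proof -
    obtain P where P: "P \<in> orbit_data" "z = base_point P" using z by blast
    have "fst (stable_dir P) * snd (unstable_dir P) \<noteq> fst (unstable_dir P) * snd (stable_dir P)"
      using slopes_transversal P(1) by (cases P) (auto simp: stable_dir_def unstable_dir_def)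
    then show ?thesis unfolding P(2) E_base[OF P(1)] by (rule splitting_at_lines)
  qed
  have coord: "continuous_on ?A (\<lambda>z. f (\<pi>' z) n)"
    if "continuous_on UNIV f" for f :: "_ \<Rightarrow> int \<Rightarrow> complex" and n
  proof -
    have "continuous_on UNIV (\<lambda>P. f P n)"
      using that by (rule continuous_on_product_then_coordinatewise)
    then show ?thesis using \<pi>'_cont by (rule continuous_on_compose2) auto
  qed
  have cs: "continuous_subspaces_on ?A Es"
  proof (rule continuous_subspaces_on_lines)
    show "continuous_on ?A (\<lambda>z. stable_dir (\<pi>' z))"
      unfolding stable_dir_def by (intro continuous_on_Pair coord continuous_intros)
  qed (auto simp: Es_def stable_dir_def zero_prod_def)
  have cu: "continuous_subspaces_on ?A Eu"
  proof (rule continuous_subspaces_on_lines)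
    show "continuous_on ?A (\<lambda>z. unstable_dir (\<pi>' z))"
      unfolding unstable_dir_def by (intro continuous_on_Pair coord continuous_intros)
  qed (auto simp: Eu_def unstable_dir_def zero_prod_def b_nz)
  have equiv: "frechet_derivative (henon c b) (at z) ` Es z = Es (henon c b z) \<and>
      frechet_derivative (henon c b) (at z) ` Eu z = Eu (henon c b z)" if z: "z \<in> ?A" for z
  proof -
    obtain P where P: "P \<in> orbit_data" "z = base_point P" using z by blast
    obtain \<xi> x t s where P': "P = (\<xi>, x, t, s)" by (cases P)
    note D = orbit_dataD[OF P(1)[unfolded P']]
    have "fst (stable_dir P) \<noteq> 0"
      using D(4)[of 1] b_nz by (auto simp: P' stable_dir_def)
    moreover have "unstable_multiplier P 1 \<noteq> 0"
      using D(6)[of 2] b_nz by (auto simp: P' unstable_multiplier_def)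
    ultimately show ?thesis
      unfolding P(2) frechet_derivative_at[OF henon_has_derivative, symmetric]
        base_point_shift[OF P(1), symmetric] E_base[OF P(1)] E_base[OF shift_data_mem[OF P(1)]]
      by (simp add: image_image henon_deriv_stable_dir henon_deriv_unstable_dir P(1) range_cscale_mult)
  qed
  have rates: "op_norm_on max_norm (Es z) (frechet_derivative (henon c b ^^ n) (at z)) \<le> 1 * (1 / 2) ^ n \<and>
      op_norm_on max_norm (Eu z) (frechet_derivative (inv (henon c b) ^^ n) (at z))
        \<le> \<delta> / (C * cmod b) / (l * \<theta>) ^ n" if z: "z \<in> ?A" and n: "n \<ge> 1" for z n
  proof -
    obtain P where P: "P \<in> orbit_data" "z = base_point P" using z by blast
    show ?thesis
      unfolding P(2) E_base[OF P(1)] inv_henon[OF b_nz]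
        frechet_derivative_funpow[of "henon c b", OF henon_has_derivative]
        frechet_derivative_funpow[of "henon_inv c b", OF henon_inv_has_derivative[OF b_nz]]
      using stable_contraction[OF P(1)] unstable_expansion[OF P(1) n] C_pos \<delta>_pos expansion_rate
      by (intro conjI op_norm_on_le) (auto simp: max_norm_nonneg)
  qed
  have "\<exists>N Cs Cu ls lu Es Eu.
        is_norm cscale N \<and> Cs > 0 \<and> Cu > 0 \<and> 0 < ls \<and> ls < 1 \<and> 1 < lu \<and>
        (\<forall>z\<in>?A. splitting_at (Es z) (Eu z)) \<and>
        continuous_subspaces_on ?A Es \<and> continuous_subspaces_on ?A Eu \<and>
        (\<forall>z\<in>?A. frechet_derivative (henon c b) (at z) ` Es z = Es (henon c b z) \<and>
               frechet_derivative (henon c b) (at z) ` Eu z = Eu (henon c b z)) \<and>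
        (\<forall>z\<in>?A. \<forall>n\<ge>1.
           op_norm_on N (Es z) (frechet_derivative (henon c b ^^ n) (at z)) \<le> Cs * ls ^ n \<and>
           op_norm_on N (Eu z) (frechet_derivative (inv (henon c b) ^^ n) (at z)) \<le> Cu / lu ^ n)"
    apply (rule exI[of _ max_norm], rule exI[of _ 1], rule exI[of _ "\<delta> / (C * cmod b)"],
        rule exI[of _ "1 / 2"], rule exI[of _ "l * \<theta>"], rule exI[of _ Es], rule exI[of _ Eu])
    using is_norm_max_norm split cs cu equiv rates expansion_rate C_pos \<delta>_pos b_nz
    by (intro conjI ballI allI impI) auto
  moreover have "compact ?A"
    by (rule compact_continuous_image[OF continuous_base_point compact_orbit_data])
  ultimately show ?thesis
    using diffeomorphism_henon[OF b_nz] inv unfolding hyperbolic_def by blast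
qed

section \<open>The conjugacy\<close>

text \<open>Both the inverse limit and the hyperbolic set are homeomorphic images of the compact space of orbit
tuples, by maps that turn the shift of tuples into the respective dynamics.\<close>

lemma hyperbolic_set_conjugate_to_limit:
  assumes \<A>: "\<A> = {(quad c x, x) | x. x \<in> \<Lambda>}"
  shows "\<exists>\<A>\<^sub>b \<Upsilon> \<Upsilon>'. hyperbolic (henon c b) \<A>\<^sub>b \<and>
      homeomorphism (proj_lim \<A> (henon c 0)) \<A>\<^sub>b \<Upsilon> \<Upsilon>' \<and>
      (\<forall>w \<in> proj_lim \<A> (henon c 0). \<Upsilon> (shift_map (henon c 0) w) = henon c b (\<Upsilon> w))"
proof -
  have history_onto: "history ` orbit_data = proj_lim \<A> (henon c 0)"
    using history_image by (simp add: \<A>)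
  obtain h' where h': "homeomorphism orbit_data (proj_lim \<A> (henon c 0)) history h'"
    using homeomorphism_compact[OF compact_orbit_data continuous_history history_onto inj_history] ..
  obtain \<pi>' where \<pi>': "homeomorphism orbit_data (base_point ` orbit_data) base_point \<pi>'"
    using homeomorphism_compact[OF compact_orbit_data continuous_base_point refl inj_base_point] ..
  have "homeomorphism (proj_lim \<A> (henon c 0)) (base_point ` orbit_data) (base_point \<circ> h') (history \<circ> \<pi>')"
    using homeomorphism_compose[OF homeomorphism_symD[OF h'] \<pi>'] .
  moreover have "(base_point \<circ> h') (shift_map (henon c 0) w) = henon c b ((base_point \<circ> h') w)"
    if w: "w \<in> proj_lim \<A> (henon c 0)" for w
  proof -
    obtain P where P: "P \<in> orbit_data" "w = history P"
      using w unfolding history_onto[symmetric] by blast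
    have h'_history: "h' (history Q) = Q" if "Q \<in> orbit_data" for Q
      using h' that by (simp add: homeomorphism_def)
    show ?thesis
      unfolding P(2) history_shift[OF P(1), symmetric]
      using P(1) by (simp add: h'_history shift_data_mem base_point_shift)
  qed
  ultimately show ?thesis using hyperbolic_base_points[OF \<pi>'] by blast
qed

end

lemma quad_has_field_derivative:
  "(quad c has_field_derivative 2 * z) (at z)"
  unfolding quad_def by (auto intro!: derivative_eq_intros)

lemma quad_iterate_has_field_derivative:
  "(quad c ^^ n has_field_derivative (\<Prod>j<n. 2 * (quad c ^^ j) z)) (at z)"
proof (induction n)
  case 0
  show ?case by (simp add: id_def)
next
  case (Suc n)
  show ?case
    using DERIV_chain[OF quad_has_field_derivative Suc]
    unfolding funpow.simps(2) prod.lessThan_Suc by (simp only: mult.commute)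
qed

text \<open>A complex linear map of the complex line scales every norm by one and the same factor, so the norm in the
definition of expansion drops out.\<close>

lemma expanding_quad_multipliers:
  assumes "expanding (quad c) \<Lambda>"
  obtains C l where "C > 0" "l > 1"
    "\<And>z k. z \<in> \<Lambda> \<Longrightarrow> k \<ge> 1 \<Longrightarrow> C * l ^ k \<le> cmod (\<Prod>j<k. 2 * (quad c ^^ j) z)"
proof -
  obtain N C l where N: "is_norm (*) N" and C: "C > 0" "l > 1"
    and exp: "\<And>z n. z \<in> \<Lambda> \<Longrightarrow> n \<ge> 1 \<Longrightarrow>
       C * l ^ n \<le> op_norm_on N UNIV (frechet_derivative (quad c ^^ n) (at z))"
    using assms unfolding expanding_def by metis
  have "C * l ^ k \<le> cmod (\<Prod>j<k. 2 * (quad c ^^ j) z)" if "z \<in> \<Lambda>" "k \<ge> 1" for z k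
  proof -
    let ?D = "\<Prod>j<k. 2 * (quad c ^^ j) z"
    have "frechet_derivative (quad c ^^ k) (at z) = (*) ?D"
      using quad_iterate_has_field_derivative
      by (intro frechet_derivative_at[symmetric]) (simp add: has_field_derivative_def)
    moreover have "op_norm_on N UNIV ((*) ?D) \<le> cmod ?D"
      by (rule op_norm_on_le) (use N in \<open>auto simp: is_norm_def\<close>)
    ultimately show ?thesis using exp[OF that] by simp
  qed
  then show ?thesis using that C by blast
qed

text \<open>In a sequence \<open>(quad c (z k), z k)\<close> the condition for the degenerate map says that \<open>z\<close> itself is a
backward orbit.\<close>

lemma homeomorphism_limit_graph:
  fixes \<Lambda> :: "complex set"
  assumes \<A>: "\<A> = {(quad c x, x) | x. x \<in> \<Lambda>}"
  shows "homeomorphism (proj_lim \<Lambda> (quad c)) (proj_lim \<A> (henon c 0))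
      (\<lambda>z k. (quad c (z k), z k)) (\<lambda>w k. snd (w k))"
proof (rule homeomorphismI)
  have coord: "continuous_on S (\<lambda>w. w k)" for S :: "(nat \<Rightarrow> 'z::topological_space) set" and k
    by (rule continuous_on_product_then_coordinatewise[OF continuous_on_id])
  show "continuous_on (proj_lim \<Lambda> (quad c)) (\<lambda>z k. (quad c (z k), z k))"
    unfolding quad_def
    by (rule continuous_on_coordinatewise_then_product)
      (intro continuous_on_Pair continuous_on_add continuous_on_power continuous_on_const coord)
  show "continuous_on (proj_lim \<A> (henon c 0)) (\<lambda>w k. snd (w k))"
    by (rule continuous_on_coordinatewise_then_product) (intro continuous_on_snd coord)
  show "(\<lambda>z k. (quad c (z k), z k)) ` proj_lim \<Lambda> (quad c) \<subseteq> proj_lim \<A> (henon c 0)"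
    by (auto simp: proj_lim_def \<A> henon_def quad_def)
  have w_eq: "w k = (quad c (snd (w k)), snd (w k)) \<and> snd (w k) \<in> \<Lambda>"
    if "w \<in> proj_lim \<A> (henon c 0)" for w k
  proof -
    have "w k \<in> \<A>" using that by (simp add: proj_lim_def)
    then show ?thesis by (auto simp: \<A>)
  qed
  show "(\<lambda>w k. snd (w k)) ` proj_lim \<A> (henon c 0) \<subseteq> proj_lim \<Lambda> (quad c)"
  proof (rule image_subsetI)
    fix w assume w: "w \<in> proj_lim \<A> (henon c 0)"
    have "quad c (snd (w (Suc k))) = snd (w k)" for k
    proof -
      have "henon c 0 (w (Suc k)) = w k" using w by (simp add: proj_lim_def)
      then have "snd (henon c 0 (w (Suc k))) = snd (w k)" by simp
      then have "fst (w (Suc k)) = snd (w k)" by (simp add: henon_def case_prod_beta)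
      then show ?thesis using w_eq[OF w, of "Suc k"] by (metis fst_conv)
    qed
    then show "(\<lambda>k. snd (w k)) \<in> proj_lim \<Lambda> (quad c)"
      using w_eq[OF w] by (simp add: proj_lim_def)
  qed
  show "(\<lambda>k. (quad c (snd (w k)), snd (w k))) = w" if "w \<in> proj_lim \<A> (henon c 0)" for w
    using w_eq[OF that] by auto
qed auto

theorem theorem1p3:
  fixes c :: complex and \<Lambda> :: "complex set" and \<A> :: "(complex \<times> complex) set"
  assumes "\<Lambda> \<subseteq> julia (quad c)"
    and "compact \<Lambda>"
    and "expanding (quad c) \<Lambda>"
    and "\<A> = {(quad c x, x) | x. x \<in> \<Lambda>}"
  shows "\<exists>\<epsilon>\<^sub>0>0. \<forall>b::complex. 0 < cmod b \<and> cmod b < \<epsilon>\<^sub>0 \<longrightarrow>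
           (\<exists>\<A>\<^sub>b \<Psi> \<Psi>' \<Upsilon> \<Upsilon>'.
              hyperbolic (henon c b) \<A>\<^sub>b \<and>
              homeomorphism (proj_lim \<Lambda> (quad c)) (proj_lim \<A> (henon c 0)) \<Psi> \<Psi>' \<and>
              homeomorphism (proj_lim \<A> (henon c 0)) \<A>\<^sub>b \<Upsilon> \<Upsilon>' \<and>
              (\<forall>z \<in> proj_lim \<Lambda> (quad c).
                 \<Psi> (shift_map (quad c) z) = shift_map (henon c 0) (\<Psi> z)) \<and>
              (\<forall>w \<in> proj_lim \<A> (henon c 0).
                 \<Upsilon> (shift_map (henon c 0) w) = henon c b (\<Upsilon> w)))"
proof -
  obtain C l where C: "C > 0" "l > 1"
    and exp: "\<And>z k. z \<in> \<Lambda> \<Longrightarrow> k \<ge> 1 \<Longrightarrow> C * l ^ k \<le> cmod (\<Prod>j<k. 2 * (quad c ^^ j) z)"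
    using expanding_quad_multipliers[OF assms(3)] by metis
  obtain R where R: "R > 0" "\<And>z. z \<in> \<Lambda> \<Longrightarrow> cmod z \<le> R"
    using compact_imp_bounded[OF assms(2)] unfolding bounded_pos by auto
  have "quad c -` \<Lambda> = \<Lambda>"
    using assms(3) by (simp add: expanding_def invariant_set_def)
  then have "quad c z \<in> \<Lambda>" if "z \<in> \<Lambda>" for z using that by blast
  then interpret expanding_quad c \<Lambda> C l R
    using assms(2) C exp R(2) by unfold_locales auto
  \<comment> \<open>The four smallness conditions on the parameter, the second one solved for its modulus.\<close>
  define \<epsilon> where "\<epsilon> = Min {2 * r, 4 * r\<^sup>2 / R, r * \<delta> / 2, \<delta> / 4}"
  have "\<epsilon> > 0" using r_pos \<delta>_pos R(1) by (simp add: \<epsilon>_def)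
  moreover have "\<exists>\<A>\<^sub>b \<Psi> \<Psi>' \<Upsilon> \<Upsilon>'.
              hyperbolic (henon c b) \<A>\<^sub>b \<and>
              homeomorphism (proj_lim \<Lambda> (quad c)) (proj_lim \<A> (henon c 0)) \<Psi> \<Psi>' \<and>
              homeomorphism (proj_lim \<A> (henon c 0)) \<A>\<^sub>b \<Upsilon> \<Upsilon>' \<and>
              (\<forall>z \<in> proj_lim \<Lambda> (quad c).
                 \<Psi> (shift_map (quad c) z) = shift_map (henon c 0) (\<Psi> z)) \<and>
              (\<forall>w \<in> proj_lim \<A> (henon c 0).
                 \<Upsilon> (shift_map (henon c 0) w) = henon c b (\<Upsilon> w))"
    if b: "0 < cmod b" "cmod b < \<epsilon>" for b
  proof -
    interpret henon_perturbation c \<Lambda> C l R b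
      using b R(1) by unfold_locales (auto simp: \<epsilon>_def field_simps)
    have "(\<lambda>k. (quad c (shift_map (quad c) z k), shift_map (quad c) z k))
        = shift_map (henon c 0) (\<lambda>k. (quad c (z k), z k))" for z
    proof
      fix k
      show "(quad c (shift_map (quad c) z k), shift_map (quad c) z k)
        = shift_map (henon c 0) (\<lambda>k. (quad c (z k), z k)) k"
        by (cases k) (simp_all add: shift_map_def henon_def quad_def)
    qed
    then show ?thesis
      using hyperbolic_set_conjugate_to_limit[OF assms(4)] homeomorphism_limit_graph[OF assms(4)]
      by blast
  qed
  ultimately show ?thesis by blast
qed

end
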